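(* Assume determinacy maximum. Then every game of length not greater than $\omega_1$ whose move set is an ordinal definable set of countable sequences of ordinals and whose payoff set is ordinal definable from a countable sequence of ordinals is determined.
   Context: We work in ZFC. Games: a game is given by an ordinal $\theta$ (its length), a nonempty set $S$ (the move set; one says the game is "on $S$"), and a payoff set $A$ of sequences of moves. It is a perfect information game of two players who move in turns, and at limit ordinals the first player moves (so the first player makes the moves with index $\lambda+2n$ and the second player those with index $\lambda+2n+1$, for $\lambda$ zero or a limit ordinal and $n<\omega$). Each move consists of picking an element of $S$. A position is the sequence of moves made so far at a point before the game ends. The game ends once the sequence of moves has length $\theta$; this sequence is the play. The first player wins if the play belongs to $A$; otherwise the second player wins. A strategy for a player is a mapping that assigns a valid move to every position at which it is that player's turn. A strategy is winning if the player wins whenever he follows it, regardless of the choices of the other player. A game is determined if one of the players has a winning strategy, and undetermined otherwise. A set is ordinal definable if there is an ordinal $\lambda$ such that the set is definable in $V_\lambda$ by a first-order formula with ordinal parameters. A set is ordinal definable from $x$ (belongs to $OD_x$) if it is ordinal definable in this sense with $x$ allowed as an additional parameter. Determinacy maximum is the following hypothesis: every game of length $\omega_1$ with ordinal definable payoff set and with the set of allowed moves (the move set) being an ordinal is determined. *)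

theory Defs
  imports "HOL-Library.Countable_Set"
begin

section \<open>The set-theoretic universe\<close>

text \<open>
  A type of class \<open>zfc\<close> is a universe of sets satisfying ZFC, where \<open>elts x\<close> is the collection
  (in general, class) of the members of \<open>x\<close>.  HOL sets over the type play the role of classes, and
  Foundation, Separation and Replacement are stated for arbitrary classes, as in Paulson's
  axiomatisation of ZFC in HOL.  Foundation is well-foundedness of membership.  The axiom of
  choice is not listed because it follows from Replacement and the choice operator of HOL.
\<close>

class zfc =
  fixes elts :: "'a \<Rightarrow> 'a set"
  assumes extensionality: "elts x = elts y \<Longrightarrow> x = y"
    and foundation: "wf {(x, y). x \<in> elts y}"
    and pairing: "\<exists>z. elts z = {x, y}"
    and union: "\<exists>z. elts z = (\<Union>y\<in>elts x. elts y)"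
    and power_set: "\<exists>z. elts z = {y. elts y \<subseteq> elts x}"
    and infinity: "\<exists>w. (\<exists>z\<in>elts w. elts z = {}) \<and>
                       (\<forall>x\<in>elts w. \<exists>y\<in>elts w. elts y = insert x (elts x))"
    and separation: "\<exists>z. elts z = {y \<in> elts x. P y}"
    and replacement: "\<exists>z. elts z = f ` elts x"

text \<open>The set with a given collection of members; meaningful only if there is such a set.\<close>

definition mkset :: "'a set \<Rightarrow> 'a::zfc" where
  "mkset X = (THE x. elts x = X)"

definition opair :: "'a \<Rightarrow> 'a \<Rightarrow> 'a::zfc" where
  "opair x y = mkset {mkset {x}, mkset {x, y}}"

definition osucc :: "'a \<Rightarrow> 'a::zfc" where
  "osucc x = mkset (insert x (elts x))"

definition transitive :: "'a::zfc \<Rightarrow> bool" where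
  "transitive x \<longleftrightarrow> (\<forall>y\<in>elts x. elts y \<subseteq> elts x)"

definition Ord :: "'a::zfc \<Rightarrow> bool" where
  "Ord \<alpha> \<longleftrightarrow> transitive \<alpha> \<and> (\<forall>\<beta>\<in>elts \<alpha>. transitive \<beta>)"

text \<open>
  For members of \<open>'a\<close>, countability of \<open>elts x\<close> in the sense of HOL agrees with countability inside
  the universe, since by Replacement every HOL function restricted to a set is a set.
\<close>

definition omega1 :: "'a::zfc" where
  "omega1 = (THE \<kappa>. Ord \<kappa> \<and> uncountable (elts \<kappa>) \<and> (\<forall>\<beta>\<in>elts \<kappa>. countable (elts \<beta>)))"


section \<open>Ordinal definability\<close>

text \<open>
  The cumulative hierarchy, \<open>V\<^sub>\<alpha> = \<Union>\<^bsub>\<beta><\<alpha>\<^esub> Pow V\<^sub>\<beta>\<close>, with each level given by the collection of its members.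
\<close>

function Vlevel :: "'a::zfc \<Rightarrow> 'a set" where
  "Vlevel \<alpha> = (\<Union>\<beta>\<in>elts \<alpha>. {x. elts x \<subseteq> Vlevel \<beta>})"
  by auto
termination
  by (relation "{(x, y). x \<in> elts y}") (auto simp: foundation)

declare Vlevel.simps [simp del]

text \<open>First-order formulas of the language of set theory, with variables indexed by \<open>nat\<close>.\<close>

datatype fm = Mem nat nat | Eq nat nat | Neg fm | Conj fm fm | Forall nat fm

primrec sat :: "'a::zfc set \<Rightarrow> fm \<Rightarrow> (nat \<Rightarrow> 'a) \<Rightarrow> bool" where
  "sat M (Mem i j) e \<longleftrightarrow> e i \<in> elts (e j)"
| "sat M (Eq i j) e \<longleftrightarrow> e i = e j"
| "sat M (Neg \<phi>) e \<longleftrightarrow> \<not> sat M \<phi> e"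
| "sat M (Conj \<phi> \<psi>) e \<longleftrightarrow> sat M \<phi> e \<and> sat M \<psi> e"
| "sat M (Forall i \<phi>) e \<longleftrightarrow> (\<forall>x\<in>M. sat M \<phi> (e(i := x)))"

text \<open>
  \<open>x\<close> is definable in \<open>V\<^sub>\<delta>\<close> with parameters from \<open>P\<close>: it is the unique element of \<open>V\<^sub>\<delta>\<close> satisfying
  \<open>\<phi>\<close> as the value of variable 0, the other variables being assigned parameters.  Only the finitely
  many variables occurring in \<open>\<phi>\<close> matter, so only finitely many parameters are used.
\<close>

definition definable_in_level :: "'a::zfc \<Rightarrow> 'a set \<Rightarrow> 'a \<Rightarrow> bool" where
  "definable_in_level \<delta> P x \<longleftrightarrow>
     (\<exists>\<phi> e. (\<forall>n. e n \<in> P \<inter> Vlevel \<delta>) \<and> x \<in> Vlevel \<delta> \<and>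
            (\<forall>y\<in>Vlevel \<delta>. sat (Vlevel \<delta>) \<phi> (e(0 := y)) \<longleftrightarrow> y = x))"

definition OD :: "'a::zfc \<Rightarrow> bool" where
  "OD x \<longleftrightarrow> (\<exists>\<delta>. Ord \<delta> \<and> definable_in_level \<delta> {\<alpha>. Ord \<alpha>} x)"

definition OD_from :: "'a::zfc \<Rightarrow> 'a \<Rightarrow> bool" where
  "OD_from s x \<longleftrightarrow> (\<exists>\<delta>. Ord \<delta> \<and> definable_in_level \<delta> (insert s {\<alpha>. Ord \<alpha>}) x)"


section \<open>Transfinite sequences and games\<close>

text \<open>The sequence \<open>\<langle>g \<xi> | \<xi> < \<theta>\<rangle>\<close> as a set of ordered pairs.\<close>

definition seq :: "'a \<Rightarrow> ('a \<Rightarrow> 'a) \<Rightarrow> 'a::zfc" where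
  "seq \<theta> g = mkset ((\<lambda>\<xi>. opair \<xi> (g \<xi>)) ` elts \<theta>)"

definition moves :: "'a \<Rightarrow> 'a \<Rightarrow> ('a::zfc \<Rightarrow> 'a) set" where
  "moves \<theta> S = {g. \<forall>\<xi>\<in>elts \<theta>. g \<xi> \<in> elts S}"

definition countable_ord_seq :: "'a::zfc \<Rightarrow> bool" where
  "countable_ord_seq x \<longleftrightarrow>
     (\<exists>\<alpha> g. Ord \<alpha> \<and> countable (elts \<alpha>) \<and> (\<forall>\<xi>\<in>elts \<alpha>. Ord (g \<xi>)) \<and> x = seq \<alpha> g)"

definition zero_or_limit :: "'a::zfc \<Rightarrow> bool" where
  "zero_or_limit \<delta> \<longleftrightarrow> Ord \<delta> \<and> (\<nexists>\<beta>. \<delta> = osucc \<beta>)"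

definition first_turn :: "'a::zfc \<Rightarrow> bool" where
  "first_turn \<xi> \<longleftrightarrow> (\<exists>\<delta> n. zero_or_limit \<delta> \<and> \<xi> = (osucc ^^ (2 * n)) \<delta>)"

definition second_turn :: "'a::zfc \<Rightarrow> bool" where
  "second_turn \<xi> \<longleftrightarrow> (\<exists>\<delta> n. zero_or_limit \<delta> \<and> \<xi> = (osucc ^^ (2 * n + 1)) \<delta>)"

text \<open>The game of length \<open>\<theta>\<close> on the set \<open>S\<close> with payoff set \<open>A\<close>.\<close>

definition game :: "'a::zfc \<Rightarrow> 'a \<Rightarrow> 'a \<Rightarrow> bool" where
  "game \<theta> S A \<longleftrightarrow> Ord \<theta> \<and> elts S \<noteq> {} \<and> elts A \<subseteq> seq \<theta> ` moves \<theta> S"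

text \<open>
  In the following, \<open>turn\<close> is \<open>first_turn\<close> or \<open>second_turn\<close> and singles out a player.  The values of
  a strategy at other sets than positions where it is that player's turn are irrelevant.
\<close>

definition strategy :: "('a::zfc \<Rightarrow> bool) \<Rightarrow> 'a \<Rightarrow> 'a \<Rightarrow> ('a \<Rightarrow> 'a) \<Rightarrow> bool" where
  "strategy turn \<theta> S \<sigma> \<longleftrightarrow>
     (\<forall>\<xi>\<in>elts \<theta>. turn \<xi> \<longrightarrow> (\<forall>g\<in>moves \<xi> S. \<sigma> (seq \<xi> g) \<in> elts S))"

definition follows :: "('a::zfc \<Rightarrow> bool) \<Rightarrow> 'a \<Rightarrow> ('a \<Rightarrow> 'a) \<Rightarrow> ('a \<Rightarrow> 'a) \<Rightarrow> bool" where
  "follows turn \<theta> \<sigma> g \<longleftrightarrow> (\<forall>\<xi>\<in>elts \<theta>. turn \<xi> \<longrightarrow> g \<xi> = \<sigma> (seq \<xi> g))"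

definition first_wins_by :: "'a::zfc \<Rightarrow> 'a \<Rightarrow> 'a \<Rightarrow> ('a \<Rightarrow> 'a) \<Rightarrow> bool" where
  "first_wins_by \<theta> S A \<sigma> \<longleftrightarrow> strategy first_turn \<theta> S \<sigma> \<and>
     (\<forall>g\<in>moves \<theta> S. follows first_turn \<theta> \<sigma> g \<longrightarrow> seq \<theta> g \<in> elts A)"

definition second_wins_by :: "'a::zfc \<Rightarrow> 'a \<Rightarrow> 'a \<Rightarrow> ('a \<Rightarrow> 'a) \<Rightarrow> bool" where
  "second_wins_by \<theta> S A \<tau> \<longleftrightarrow> strategy second_turn \<theta> S \<tau> \<and>
     (\<forall>g\<in>moves \<theta> S. follows second_turn \<theta> \<tau> g \<longrightarrow> seq \<theta> g \<notin> elts A)"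

definition determined :: "'a::zfc \<Rightarrow> 'a \<Rightarrow> 'a \<Rightarrow> bool" where
  "determined \<theta> S A \<longleftrightarrow> (\<exists>\<sigma>. first_wins_by \<theta> S A \<sigma>) \<or> (\<exists>\<tau>. second_wins_by \<theta> S A \<tau>)"

text \<open>The argument \<open>U\<close> only names the universe in which the hypothesis is stated.\<close>

definition determinacy_maximum :: "'a::zfc itself \<Rightarrow> bool" where
  "determinacy_maximum U \<longleftrightarrow>
     (\<forall>(S::'a) A. game omega1 S A \<and> Ord S \<and> OD A \<longrightarrow> determined omega1 S A)"

end

theory Submission
  imports Defs
begin

text \<open>
  Given a game of length \<open>\<theta>\<close> on \<open>S\<close> with payoff \<open>A\<close> definable from \<open>s\<close>, consider the game of length \<open>\<omega>\<^sub>1\<close>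
  with ordinal moves in which the first player proposes some \<open>s'\<close>, then the second player chooses
  which of the two roles to take in the game with payoff \<open>A\<^bsub>s'\<^esub>\<close>, and then that game is played, each of
  its moves being coded by \<open>\<omega>\<close> ordinals.  The parameter has become part of the play, so the payoff set
  is ordinal definable and the game is determined.  The first player cannot win it: a winning strategy
  would win the same game \<open>A\<^bsub>s'\<^esub>\<close> in both roles, and could be played against itself.  So the second
  player has a winning strategy, and its answer to \<open>s' = s\<close> wins the given game in the chosen role.
\<close>

section \<open>Sets and ordinals\<close>

text \<open>An ordinal definable \<open>S\<close> need not have an ordinal definable member, so the
  replacement for moves that code nothing in \<open>S\<close> cannot be fixed in advance. It too
  becomes part of the play, proposed by the second player, who loses by proposing something outside
  \<open>S\<close>. The parameter needs no such rule: \<open>As s'\<close> makes sense for every set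
  \<open>s'\<close>, being the union of all \<open>A'\<close> that satisfy the definition of
  \<open>A\<close> with \<open>s'\<close> for \<open>s\<close>. So every proposal leaves a genuine
  game, and the first player's strategy can be refuted whatever it proposes.

  In each block of length \<omega> both players move, but only the moves of one of them are read;
  exchanging the roles exchanges the halves that are read. That leaves room to copy each half from
  another play with a delay of one move.

  Definability is shown over \<open>V_\<delta>\<close> for a limit \<delta> above all sets involved.
  Levels, parity and block numbers are recursive notions; each enters the formula through a set in
  \<open>V_\<delta>\<close> that satisfies the recursion.\<close>

definition small :: "'a::zfc set \<Rightarrow> bool" where
  "small X \<longleftrightarrow> (\<exists>z. elts z = X)"

lemma elts_mkset [simp]: "small X \<Longrightarrow> elts (mkset X) = X"
  unfolding small_def mkset_def by (metis (mono_tags, lifting) extensionality theI')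

lemma mkset_elts [simp]: "mkset (elts x) = x"
  unfolding mkset_def by (rule the_equality) (auto intro: extensionality)

lemma small_elts [simp, intro]: "small (elts x)"
  by (auto simp: small_def)

lemma small_subset: "small Y \<Longrightarrow> X \<subseteq> Y \<Longrightarrow> small X"
proof -
  assume "small Y" "X \<subseteq> Y"
  then obtain y where "elts y = Y" by (auto simp: small_def)
  with \<open>X \<subseteq> Y\<close> have "X = {z \<in> elts y. z \<in> X}" by auto
  then show ?thesis using separation[of y "\<lambda>z. z \<in> X"] by (simp add: small_def)
qed

lemma small_image [simp, intro]: "small X \<Longrightarrow> small (f ` X)" for f :: "'a::zfc \<Rightarrow> 'a"
  unfolding small_def using replacement[of f] by blast

lemma small_UN [intro]:
  fixes f :: "'a::zfc \<Rightarrow> 'a set"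
  assumes "small X" "\<And>x. x \<in> X \<Longrightarrow> small (f x)"
  shows "small (\<Union>x\<in>X. f x)"
proof -
  obtain z where z: "elts z = (\<lambda>x. mkset (f x)) ` X"
    using small_image[OF assms(1), of "\<lambda>x. mkset (f x)"] unfolding small_def by blast
  obtain u where "elts u = (\<Union>y\<in>elts z. elts y)" using union by blast
  also have "\<dots> = (\<Union>x\<in>X. f x)" using assms(2) by (simp add: z)
  finally show ?thesis by (auto simp: small_def)
qed

lemma small_pair [simp]: "small {x, y}"
  using pairing by (metis small_def)

lemma small_singleton [simp]: "small {x}"
  using small_pair[of x x] by simp

lemma small_empty [simp]: "small {}"
  by (rule small_subset[OF small_elts]) simp

lemma small_Un [simp]: "small X \<Longrightarrow> small Y \<Longrightarrow> small (X \<union> Y)"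
  using small_UN[of "{mkset X, mkset Y}" elts] by simp

lemma small_insert [simp]: "small X \<Longrightarrow> small (insert x X)"
  using small_Un[of "{x}" X] by simp

lemma small_Pow [intro]: "small X \<Longrightarrow> small {y. elts y \<subseteq> X}"
  using power_set by (metis small_def)

lemma elts_induct: "(\<And>x. (\<And>y. y \<in> elts x \<Longrightarrow> P y) \<Longrightarrow> P x) \<Longrightarrow> P x"
  using wf_induct_rule[OF foundation, of P x] by simp

lemma elts_irrefl [simp]: "x \<notin> elts x"
  using wf_not_refl[OF foundation] by auto

lemma elts_asym: "x \<in> elts y \<Longrightarrow> y \<notin> elts x"
  using wf_not_sym[OF foundation] by auto

text \<open>The premise is the admissibility condition of \<open>wfrec\<close>. The codomain is an
  arbitrary type, so that two plays can be built simultaneously, as a function into pairs.\<close>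

lemma elts_recursion:
  fixes H :: "('a::zfc \<Rightarrow> 'b) \<Rightarrow> 'a \<Rightarrow> 'b"
  assumes "\<And>f g x. (\<And>y. y \<in> elts x \<Longrightarrow> f y = g y) \<Longrightarrow> H f x = H g x"
  shows "\<exists>f. \<forall>x. f x = H f x"
proof -
  have "adm_wf {(x, y). x \<in> elts y} H"
    unfolding adm_wf_def by (intro allI impI, rule assms) simp
  from wfrec_fixpoint[OF foundation this] show ?thesis by (intro exI allI) (rule fun_cong)
qed

definition zero :: "'a::zfc" where "zero = mkset {}"

lemma elts_zero [simp]: "elts zero = {}"
  by (simp add: zero_def)

lemma elts_eq_empty [simp]: "elts x = {} \<longleftrightarrow> x = zero"
  using extensionality[of x zero] by auto

lemma elts_osucc [simp]: "elts (osucc x) = insert x (elts x)"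
  by (simp add: osucc_def)

lemma osucc_inject [simp]: "osucc x = osucc y \<longleftrightarrow> x = y"
proof
  assume "osucc x = osucc y"
  then have "insert x (elts x) = insert y (elts y)" by (metis elts_osucc)
  then show "x = y" using elts_asym by (metis insertE insertI1)
qed simp

lemma osucc_neq_zero [simp]: "osucc x \<noteq> zero" "zero \<noteq> osucc x"
  by (metis elts_osucc elts_zero insert_not_empty)+

lemma opair_inject [simp]: "opair a b = opair c d \<longleftrightarrow> a = c \<and> b = d"
proof
  assume "opair a b = opair c d"
  then have "{mkset {a, a}, mkset {a, b}} = {mkset {c, c}, mkset {c, d}}"
    unfolding opair_def by (metis elts_mkset insert_absorb2 small_pair)
  then have "elts ` {mkset {a, a}, mkset {a, b}} = elts ` {mkset {c, c}, mkset {c, d}}" by (rule arg_cong)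
  then have "{{a}, {a, b}} = {{c}, {c, d}}" by simp
  then show "a = c \<and> b = d" by (auto simp: doubleton_eq_iff)
qed simp

lemma elts_seq [simp]: "elts (seq \<theta> g) = (\<lambda>\<xi>. opair \<xi> (g \<xi>)) ` elts \<theta>"
  by (simp add: seq_def)

lemma seq_eq_iff: "seq \<theta> f = seq \<theta>' g \<longleftrightarrow> \<theta> = \<theta>' \<and> (\<forall>\<xi>\<in>elts \<theta>. f \<xi> = g \<xi>)"
proof
  assume "seq \<theta> f = seq \<theta>' g"
  then have eq: "(\<lambda>\<xi>. opair \<xi> (f \<xi>)) ` elts \<theta> = (\<lambda>\<xi>. opair \<xi> (g \<xi>)) ` elts \<theta>'"
    by (metis elts_seq)
  have "elts \<theta> = elts \<theta>'"
  proof (intro set_eqI iffI)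
    fix x assume "x \<in> elts \<theta>"
    then have "opair x (f x) \<in> (\<lambda>\<xi>. opair \<xi> (g \<xi>)) ` elts \<theta>'" using eq by blast
    then show "x \<in> elts \<theta>'" by auto
  next
    fix x assume "x \<in> elts \<theta>'"
    then have "opair x (g x) \<in> (\<lambda>\<xi>. opair \<xi> (f \<xi>)) ` elts \<theta>" using eq by blast
    then show "x \<in> elts \<theta>" by auto
  qed
  moreover have "f \<xi> = g \<xi>" if "\<xi> \<in> elts \<theta>" for \<xi>
  proof -
    have "opair \<xi> (f \<xi>) \<in> (\<lambda>\<xi>. opair \<xi> (g \<xi>)) ` elts \<theta>'" using eq that by blast
    then show ?thesis by auto
  qed
  ultimately show "\<theta> = \<theta>' \<and> (\<forall>\<xi>\<in>elts \<theta>. f \<xi> = g \<xi>)" by (auto intro: extensionality)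
qed (auto intro!: extensionality)

lemma seq_cong: "(\<And>\<xi>. \<xi> \<in> elts \<theta> \<Longrightarrow> f \<xi> = g \<xi>) \<Longrightarrow> seq \<theta> f = seq \<theta> g"
  by (simp add: seq_eq_iff)

lemma Ord_in_Ord: "Ord \<alpha> \<Longrightarrow> \<beta> \<in> elts \<alpha> \<Longrightarrow> Ord \<beta>"
  unfolding Ord_def transitive_def by blast

lemma Ord_trans: "Ord \<alpha> \<Longrightarrow> \<beta> \<in> elts \<alpha> \<Longrightarrow> \<gamma> \<in> elts \<beta> \<Longrightarrow> \<gamma> \<in> elts \<alpha>"
  by (auto simp: Ord_def transitive_def)

lemma OrdI: "(\<And>\<beta>. \<beta> \<in> elts \<alpha> \<Longrightarrow> Ord \<beta> \<and> elts \<beta> \<subseteq> elts \<alpha>) \<Longrightarrow> Ord \<alpha>"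
  by (auto simp: Ord_def transitive_def)

lemma Ord_osucc [simp, intro]: "Ord \<alpha> \<Longrightarrow> Ord (osucc \<alpha>)"
  by (rule OrdI) (auto intro: Ord_in_Ord Ord_trans)

lemma Ord_osucc_iff: "Ord (osucc \<alpha>) \<longleftrightarrow> Ord \<alpha>"
  by (metis Ord_in_Ord Ord_osucc elts_osucc insertI1)

lemma Ord_zero [simp]: "Ord zero"
  by (rule OrdI) simp

lemma Ord_linear: "Ord \<alpha> \<Longrightarrow> Ord \<beta> \<Longrightarrow> \<alpha> \<in> elts \<beta> \<or> \<alpha> = \<beta> \<or> \<beta> \<in> elts \<alpha>"
proof (induction \<alpha> arbitrary: \<beta> rule: elts_induct)
  case (1 \<alpha>)
  note outer = this
  from \<open>Ord \<beta>\<close> show ?case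
  proof (induction \<beta> rule: elts_induct)
    case (1 \<beta>)
    show ?case
    proof (rule ccontr)
      assume no: "\<not> ?thesis"
      have "x \<in> elts \<beta>" if "x \<in> elts \<alpha>" for x
        using outer(1)[OF that _ \<open>Ord \<beta>\<close>] outer(2) that no by (metis Ord_in_Ord Ord_trans)
      moreover have "x \<in> elts \<alpha>" if "x \<in> elts \<beta>" for x
        using 1(1)[OF that] 1(2) that no by (metis Ord_in_Ord Ord_trans)
      ultimately show False using no extensionality by blast
    qed
  qed
qed

lemma Ord_UN_osucc:
  fixes f :: "'a::zfc \<Rightarrow> 'a"
  assumes "small X" "\<And>x. x \<in> X \<Longrightarrow> Ord (f x)"
  shows "Ord (mkset (\<Union>x\<in>X. elts (osucc (f x))))"
    and "elts (mkset (\<Union>x\<in>X. elts (osucc (f x)))) = (\<Union>x\<in>X. elts (osucc (f x)))"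
proof -
  show eq: "elts (mkset (\<Union>x\<in>X. elts (osucc (f x)))) = (\<Union>x\<in>X. elts (osucc (f x)))"
    by (rule elts_mkset[OF small_UN[OF assms(1)]]) (rule small_elts)
  show "Ord (mkset (\<Union>x\<in>X. elts (osucc (f x))))"
    by (rule OrdI, unfold eq) (use assms(2) in \<open>fastforce intro: Ord_in_Ord Ord_trans\<close>)
qed

lemma Ord_bound:
  assumes "small X" "\<And>x. x \<in> X \<Longrightarrow> Ord x"
  shows "\<exists>\<kappa>. Ord \<kappa> \<and> X \<subseteq> elts \<kappa>"
  using Ord_UN_osucc[OF assms(1), of "\<lambda>x. x"] assms(2) by fastforce

lemma Ord_not_small: "\<not> small {\<alpha>::'a::zfc. Ord \<alpha>}"
proof
  assume "small {\<alpha>::'a. Ord \<alpha>}"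
  then obtain \<kappa> :: 'a where "Ord \<kappa>" "{\<alpha>. Ord \<alpha>} \<subseteq> elts \<kappa>" using Ord_bound by blast
  then show False by auto
qed

lemma Ord_osucc_pow: "Ord ((osucc ^^ n) \<alpha>) \<longleftrightarrow> Ord \<alpha>"
  by (induction n) (auto simp: Ord_osucc_iff)

lemma osucc_pow_mem: "n < m \<Longrightarrow> (osucc ^^ n) x \<in> elts ((osucc ^^ m) x)"
  by (induction m) (auto simp: less_Suc_eq)

lemma inj_osucc_pow: "inj (\<lambda>n. (osucc ^^ n) x)"
proof (rule injI)
  fix n m assume "(osucc ^^ n) x = (osucc ^^ m) x"
  then show "n = m" using osucc_pow_mem[of n m x] osucc_pow_mem[of m n x]
    by (cases n m rule: linorder_cases) auto
qed

section \<open>The set of finite ordinals and the first uncountable ordinal\<close>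

lemma nats_small: "small (range (\<lambda>n. (osucc ^^ n) zero))"
proof -
  obtain w :: 'a where w: "\<exists>z\<in>elts w. elts z = {}"
    "\<forall>x\<in>elts w. \<exists>y\<in>elts w. elts y = insert x (elts x)" using infinity by blast
  have "(osucc ^^ n) zero \<in> elts w" for n
  proof (induction n)
    case 0
    then show ?case using w(1) by auto
  next
    case (Suc n)
    then obtain y where "y \<in> elts w" "elts y = elts (osucc ((osucc ^^ n) zero))" using w(2) by auto
    then show ?case using extensionality[of y "osucc ((osucc ^^ n) zero)"] by auto
  qed
  then show ?thesis by (intro small_subset[OF small_elts[of w]]) auto
qed

lemma small_range_nat [simp]: "small (range (f :: nat \<Rightarrow> 'a::zfc))"
proof -
  let ?h = "\<lambda>n. (osucc ^^ n) (zero::'a)"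
  have "range f = (\<lambda>x. f (inv ?h x)) ` range ?h"
    by (simp add: image_image inv_f_f[OF inj_osucc_pow])
  then show ?thesis using small_image[OF nats_small] by simp
qed

text \<open>Cantor's theorem for sets of naturals, transported to the power set of the von Neumann
  numerals.\<close>

lemma uncountable_set_exists: "\<exists>X::'a::zfc. uncountable (elts X)"
proof -
  let ?h = "\<lambda>n. (osucc ^^ n) (zero::'a)"
  obtain X :: 'a where X: "elts X = {y. elts y \<subseteq> range ?h}"
    using small_Pow[OF nats_small] by (auto simp: small_def)
  have sm: "small (?h ` A)" for A by (rule small_subset[OF nats_small]) auto
  have inj: "inj (\<lambda>A. mkset (?h ` A))"
    by (rule injI) (metis sm elts_mkset inj_image_eq_iff inj_osucc_pow)
  have "countable (UNIV :: nat set set)" if "countable (elts X)"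
  proof (rule countable_image_inj_on[OF _ inj])
    show "countable (range (\<lambda>A. mkset (?h ` A)))"
      by (rule countable_subset[OF _ that]) (auto simp: X sm)
  qed
  moreover have "uncountable (UNIV :: nat set set)"
  proof
    assume "countable (UNIV :: nat set set)"
    then obtain f :: "nat \<Rightarrow> nat set" where "range f = UNIV"
      by (metis UNIV_I empty_iff range_from_nat_into)
    then show False using Cantors_theorem[of "UNIV :: nat set"] by auto
  qed
  ultimately show ?thesis by blast
qed

lemma uncountable_ordinal_exists: "\<exists>\<kappa>::'a::zfc. Ord \<kappa> \<and> uncountable (elts \<kappa>)"
proof (rule ccontr)
  assume "\<not> ?thesis"
  then have ctb: "countable (elts \<alpha>)" if "Ord \<alpha>" for \<alpha> :: 'a using that by blast
  obtain X :: 'a where X: "uncountable (elts X)" using uncountable_set_exists by blast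
  have "\<exists>f::'a\<Rightarrow>'a. \<forall>\<alpha>. f \<alpha> = (SOME x. x \<in> elts X - f ` elts \<alpha>)"
    by (rule elts_recursion) (metis image_cong)
  then obtain f :: "'a \<Rightarrow> 'a" where f: "\<And>\<alpha>. f \<alpha> = (SOME x. x \<in> elts X - f ` elts \<alpha>)" by blast
  have fX: "f \<alpha> \<in> elts X - f ` elts \<alpha>" if "Ord \<alpha>" for \<alpha>
  proof -
    have "elts X - f ` elts \<alpha> \<noteq> {}"
      using X ctb[OF that] by (metis countable_image countable_subset Diff_eq_empty_iff)
    then show ?thesis using f[of \<alpha>] by (metis all_not_in_conv someI_ex)
  qed
  then have inj: "inj_on f {\<alpha>. Ord \<alpha>}" by (intro inj_onI) (metis Diff_iff Ord_linear imageI mem_Collect_eq)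
  have "small (f ` {\<alpha>. Ord \<alpha>})" by (rule small_subset[OF small_elts[of X]]) (use fX in auto)
  then have "small (inv_into {\<alpha>. Ord \<alpha>} f ` f ` {\<alpha>. Ord \<alpha>})" by (rule small_image)
  then show False using Ord_not_small[where ?'a = 'a] inv_into_image_cancel[OF inj, of "{\<alpha>. Ord \<alpha>}"] by simp
qed

lemma omega1: "Ord (omega1::'a::zfc)" "uncountable (elts (omega1::'a))"
  "\<beta> \<in> elts (omega1::'a) \<Longrightarrow> countable (elts \<beta>)"
proof -
  let ?P = "\<lambda>\<kappa>::'a. Ord \<kappa> \<and> uncountable (elts \<kappa>) \<and> (\<forall>\<beta>\<in>elts \<kappa>. countable (elts \<beta>))"
  obtain \<kappa>0 :: 'a where k0: "Ord \<kappa>0" "uncountable (elts \<kappa>0)" using uncountable_ordinal_exists by blast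
  have "\<exists>\<kappa>. ?P \<kappa>" using k0
    by (induction \<kappa>0 rule: elts_induct) (metis Ord_in_Ord)
  then obtain \<kappa> where k: "?P \<kappa>" by blast
  have "?P omega1" unfolding omega1_def
    by (rule theI[of ?P, OF k]) (use k Ord_linear in blast)
  then show "Ord (omega1::'a)" "uncountable (elts (omega1::'a))"
    "\<beta> \<in> elts (omega1::'a) \<Longrightarrow> countable (elts \<beta>)" by auto
qed

lemma countable_Ord_in_omega1: "Ord \<alpha> \<Longrightarrow> countable (elts \<alpha>) \<Longrightarrow> \<alpha> \<in> elts omega1"
  using Ord_linear[of \<alpha> omega1] omega1 Ord_trans by (metis countable_subset subsetI)

lemma osucc_in_omega1 [intro]: "\<alpha> \<in> elts omega1 \<Longrightarrow> osucc \<alpha> \<in> elts omega1"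
  by (rule countable_Ord_in_omega1) (auto intro: Ord_in_Ord omega1)

lemma omega1_trans: "\<alpha> \<in> elts omega1 \<Longrightarrow> \<beta> \<in> elts \<alpha> \<Longrightarrow> \<beta> \<in> elts omega1"
  using omega1(1) Ord_trans by blast

lemma zero_in_omega1 [simp]: "zero \<in> elts omega1"
  by (rule countable_Ord_in_omega1) auto

section \<open>Limit and finite parts, turns\<close>

lemma zero_or_limit_zero [simp]: "zero_or_limit zero"
  by (simp add: zero_or_limit_def)

lemma not_limit_osucc [simp]: "\<not> zero_or_limit (osucc \<alpha>)"
  by (auto simp: zero_or_limit_def)

lemma limit_Ord: "zero_or_limit \<alpha> \<Longrightarrow> Ord \<alpha>"
  by (simp add: zero_or_limit_def)

lemma osucc_mem_or_eq: "Ord \<alpha> \<Longrightarrow> \<beta> \<in> elts \<alpha> \<Longrightarrow> osucc \<beta> \<in> elts \<alpha> \<or> osucc \<beta> = \<alpha>"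
  using Ord_linear[of "osucc \<beta>" \<alpha>] Ord_in_Ord[of \<alpha> \<beta>]
  by (metis Ord_osucc elts_asym elts_irrefl elts_osucc insertE)

lemma limit_osucc_mem: "zero_or_limit \<alpha> \<Longrightarrow> \<beta> \<in> elts \<alpha> \<Longrightarrow> osucc \<beta> \<in> elts \<alpha>"
  using osucc_mem_or_eq unfolding zero_or_limit_def by metis

lemma limit_osucc_mem_iff: "zero_or_limit \<alpha> \<Longrightarrow> osucc \<beta> \<in> elts \<alpha> \<longleftrightarrow> \<beta> \<in> elts \<alpha>"
  using limit_osucc_mem[of \<alpha> \<beta>] Ord_trans[of \<alpha> "osucc \<beta>" \<beta>] limit_Ord[of \<alpha>] by auto

lemma limit_part_exists: "Ord \<alpha> \<Longrightarrow> \<exists>\<delta> n. zero_or_limit \<delta> \<and> \<alpha> = (osucc ^^ n) \<delta>"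
proof (induction \<alpha> rule: elts_induct)
  case (1 \<alpha>)
  show ?case
  proof (cases "zero_or_limit \<alpha>")
    case True
    then show ?thesis by (metis funpow_0)
  next
    case False
    then obtain \<beta> where b: "\<alpha> = osucc \<beta>" using 1(2) by (auto simp: zero_or_limit_def)
    then obtain \<delta> n where "zero_or_limit \<delta>" "\<beta> = (osucc ^^ n) \<delta>"
      using 1 by (metis Ord_osucc_iff elts_osucc insertI1)
    then have "zero_or_limit \<delta> \<and> \<alpha> = (osucc ^^ Suc n) \<delta>" using b by simp
    then show ?thesis by blast
  qed
qed

lemma limit_part_unique:
  "zero_or_limit \<delta> \<Longrightarrow> zero_or_limit \<delta>' \<Longrightarrow> (osucc ^^ n) \<delta> = (osucc ^^ m) \<delta>' \<Longrightarrow> n = m \<and> \<delta> = \<delta>'"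
proof (induction n arbitrary: m)
  case 0
  then show ?case by (cases m) auto
next
  case (Suc n)
  then show ?case by (cases m) auto
qed

definition fin_part :: "'a::zfc \<Rightarrow> nat" where
  "fin_part \<alpha> = (THE n. \<exists>\<delta>. zero_or_limit \<delta> \<and> \<alpha> = (osucc ^^ n) \<delta>)"

lemma fin_part_pow: "zero_or_limit \<delta> \<Longrightarrow> fin_part ((osucc ^^ n) \<delta>) = n"
  unfolding fin_part_def by (rule the_equality) (auto dest: limit_part_unique)

lemma fin_part_osucc: "Ord \<alpha> \<Longrightarrow> fin_part (osucc \<alpha>) = Suc (fin_part \<alpha>)"
  using limit_part_exists[of \<alpha>] fin_part_pow[of _ "Suc _"] by (auto simp: fin_part_pow)

lemma fin_part_limit: "zero_or_limit \<alpha> \<Longrightarrow> fin_part \<alpha> = 0"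
  using fin_part_pow[of \<alpha> 0] by simp

lemma first_turn_iff: "Ord \<alpha> \<Longrightarrow> first_turn \<alpha> \<longleftrightarrow> even (fin_part \<alpha>)"
proof -
  assume "Ord \<alpha>"
  then obtain \<delta> n where d: "zero_or_limit \<delta>" "\<alpha> = (osucc ^^ n) \<delta>" using limit_part_exists by blast
  then have "first_turn \<alpha> \<longleftrightarrow> (\<exists>m. n = 2 * m)"
    unfolding first_turn_def using limit_part_unique by metis
  then show ?thesis using d by (simp add: fin_part_pow dvd_def)
qed

lemma second_turn_iff: "Ord \<alpha> \<Longrightarrow> second_turn \<alpha> \<longleftrightarrow> \<not> first_turn \<alpha>"
proof -
  assume a: "Ord \<alpha>"
  then obtain \<delta> n where d: "zero_or_limit \<delta>" "\<alpha> = (osucc ^^ n) \<delta>" using limit_part_exists by blast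
  then have "second_turn \<alpha> \<longleftrightarrow> (\<exists>m. n = 2 * m + 1)"
    unfolding second_turn_def using limit_part_unique by metis
  also have "\<dots> \<longleftrightarrow> odd n" by (auto elim: oddE)
  finally show ?thesis using d a by (simp add: fin_part_pow first_turn_iff)
qed

lemma first_turn_osucc: "Ord \<alpha> \<Longrightarrow> first_turn (osucc \<alpha>) \<longleftrightarrow> \<not> first_turn \<alpha>"
  by (simp add: first_turn_iff fin_part_osucc)

lemma first_turn_limit: "zero_or_limit \<alpha> \<Longrightarrow> first_turn \<alpha>"
  by (simp add: first_turn_iff fin_part_limit limit_Ord)

lemma second_turn_pred: "Ord \<alpha> \<Longrightarrow> \<not> first_turn \<alpha> \<Longrightarrow> \<exists>\<beta>. \<alpha> = osucc \<beta> \<and> Ord \<beta> \<and> first_turn \<beta>"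
  by (metis first_turn_limit first_turn_osucc Ord_osucc_iff zero_or_limit_def)

text \<open>The witness is \<alpha> + \<omega>. The bound on its members is kept because it shows
  that the witness is countable whenever \<alpha> is.\<close>

lemma limit_above:
  assumes "Ord \<alpha>"
  shows "\<exists>\<delta>. zero_or_limit \<delta> \<and> \<alpha> \<in> elts \<delta> \<and> elts \<delta> \<subseteq> (\<Union>n. elts (osucc ((osucc ^^ n) \<alpha>)))"
proof -
  let ?d = "mkset (\<Union>x\<in>range (\<lambda>n. (osucc ^^ n) \<alpha>). elts (osucc x))"
  have d: "Ord ?d" "elts ?d = (\<Union>n. elts (osucc ((osucc ^^ n) \<alpha>)))"
    using Ord_UN_osucc[OF small_range_nat, of "\<lambda>n. (osucc ^^ n) \<alpha>" "\<lambda>x. x"] assms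
    by (fastforce simp: Ord_osucc_pow image_image simp del: elts_osucc)+
  have "?d \<noteq> osucc \<beta>" for \<beta>
  proof
    assume eq: "?d = osucc \<beta>"
    then have "\<beta> \<in> elts ?d" by simp
    then obtain n where "\<beta> \<in> elts (osucc ((osucc ^^ n) \<alpha>))" using d(2) by auto
    then have "\<beta> \<in> elts ((osucc ^^ Suc n) \<alpha>)" by simp
    moreover have "(osucc ^^ Suc n) \<alpha> \<in> elts ?d" using d(2) by (metis UN_I UNIV_I elts_osucc insertI1)
    ultimately show False using eq by (metis elts_asym elts_irrefl elts_osucc insertE)
  qed
  then have "zero_or_limit ?d" using d(1) by (auto simp: zero_or_limit_def)
  moreover have "\<alpha> \<in> elts ?d" unfolding d(2) by (auto intro: exI[of _ 0])
  ultimately show ?thesis using d(2) by blast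
qed

lemma limit_above_in_omega1:
  assumes "\<alpha> \<in> elts omega1"
  shows "\<exists>\<delta>\<in>elts omega1. zero_or_limit \<delta> \<and> \<alpha> \<in> elts \<delta>"
proof -
  have *: "(osucc ^^ n) \<alpha> \<in> elts omega1" for n using assms by (induction n) auto
  obtain \<delta> where d: "zero_or_limit \<delta>" "\<alpha> \<in> elts \<delta>" "elts \<delta> \<subseteq> (\<Union>n. elts (osucc ((osucc ^^ n) \<alpha>)))"
    using limit_above[OF Ord_in_Ord[OF omega1(1) assms]] by auto
  have "countable (\<Union>n. elts (osucc ((osucc ^^ n) \<alpha>)))"
    by (intro countable_UN[OF countableI_type]) (rule omega1(3)[OF osucc_in_omega1[OF *]])
  then have "countable (elts \<delta>)" using d(3) countable_subset by blast
  then show ?thesis using d(1,2) countable_Ord_in_omega1[OF limit_Ord] by auto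
qed

section \<open>Coding a game by a game with ordinal moves\<close>

text \<open>A zero announces a pair, and the components are shifted by one so that they cannot be
  mistaken for that mark. Entries outside such triples are ignored; the constant zero codes the
  empty set.\<close>

definition codes :: "(nat \<Rightarrow> 'a) \<Rightarrow> 'a::zfc \<Rightarrow> bool" where
  "codes c x \<longleftrightarrow> elts x =
     {opair a b |a b. \<exists>n. c n = zero \<and> c (Suc n) = osucc a \<and> c (Suc (Suc n)) = osucc b}"

definition two :: "'a::zfc \<Rightarrow> 'a" where "two \<eta> = osucc (osucc \<eta>)"

text \<open>The number of a move among those of the same player since the last limit.
  \<open>two\<close> leads to that player's next move, so \<open>dec\<close> reads the moves of one
  player just as \<open>codes\<close> reads a sequence.\<close>

definition half :: "'a::zfc \<Rightarrow> nat" where "half \<eta> = fin_part \<eta> div 2"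

definition triple :: "('a \<Rightarrow> 'a::zfc) \<Rightarrow> 'a \<Rightarrow> 'a \<Rightarrow> 'a \<Rightarrow> bool" where
  "triple p \<eta> a b \<longleftrightarrow> p \<eta> = zero \<and> p (two \<eta>) = osucc a \<and> p (two (two \<eta>)) = osucc b"

definition dec :: "('a \<Rightarrow> 'a::zfc) \<Rightarrow> 'a set \<Rightarrow> 'a" where
  "dec p X = mkset {opair a b |a b. \<exists>\<eta>\<in>X. triple p \<eta> a b}"

lemma elts_dec:
  assumes "small X"
  shows "elts (dec p X) = {opair a b |a b. \<exists>\<eta>\<in>X. triple p \<eta> a b}"
  unfolding dec_def
proof (rule elts_mkset, rule small_subset)
  let ?f = "\<lambda>\<eta>. opair (inv osucc (p (two \<eta>))) (inv osucc (p (two (two \<eta>))))"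
  show "small (?f ` X)" using assms by (rule small_image)
  have "inj (osucc :: 'a \<Rightarrow> 'a)" by (rule injI) simp
  then have *: "inv osucc (osucc a) = a" for a :: 'a by simp
  show "{opair a b |a b. \<exists>\<eta>\<in>X. triple p \<eta> a b} \<subseteq> ?f ` X"
    by (auto simp: triple_def * intro!: rev_image_eqI)
qed

lemma dec_cong:
  assumes "\<And>\<eta>. \<eta> \<in> X \<Longrightarrow> two \<eta> \<in> X" "\<And>\<eta>. \<eta> \<in> X \<Longrightarrow> p \<eta> = q \<eta>"
  shows "dec p X = dec q X"
proof -
  have "triple p \<eta> a b \<longleftrightarrow> triple q \<eta> a b" if "\<eta> \<in> X" for \<eta> a b
    using that assms by (simp add: triple_def)
  then show ?thesis unfolding dec_def by (intro arg_cong[of _ _ mkset]) blast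
qed

lemma half_two: "Ord \<eta> \<Longrightarrow> half (two \<eta>) = Suc (half \<eta>)"
  by (simp add: half_def two_def fin_part_osucc)

lemma first_turn_two: "Ord \<eta> \<Longrightarrow> first_turn (two \<eta>) \<longleftrightarrow> first_turn \<eta>"
  by (simp add: two_def first_turn_osucc)

text \<open>\<open>X\<close> may extend over many blocks. Every index then recurs, but always with
  the same entry of \<open>c\<close>, so no new triples arise.\<close>

lemma dec_codes:
  assumes "small X" "\<And>\<eta>. \<eta> \<in> X \<Longrightarrow> two \<eta> \<in> X" "\<And>\<eta>. \<eta> \<in> X \<Longrightarrow> Ord \<eta>"
    and "\<And>\<eta>. \<eta> \<in> X \<Longrightarrow> p \<eta> = c (half \<eta>)" "\<And>n. \<exists>\<eta>\<in>X. half \<eta> = n" "codes c x"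
  shows "dec p X = x"
proof (rule extensionality)
  have "(\<exists>\<eta>\<in>X. triple p \<eta> a b) \<longleftrightarrow>
      (\<exists>n. c n = zero \<and> c (Suc n) = osucc a \<and> c (Suc (Suc n)) = osucc b)" for a b
  proof -
    have "triple p \<eta> a b \<longleftrightarrow> c (half \<eta>) = zero \<and> c (Suc (half \<eta>)) = osucc a \<and>
        c (Suc (Suc (half \<eta>))) = osucc b" if "\<eta> \<in> X" for \<eta>
      using that assms(2-4) by (simp add: triple_def half_two)
    then show ?thesis using assms(5) by metis
  qed
  then show "elts (dec p X) = elts x"
    using assms(6) by (simp add: elts_dec[OF assms(1)] codes_def)
qed

text \<open>The graph is listed along an enumeration \<open>f\<close> of the domain, repetitions
  allowed, with three entries for each pair. The empty sequence has no such enumeration and gets the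
  constant zero.\<close>

lemma countable_ord_seq_codes:
  fixes x :: "'a::zfc"
  assumes "countable_ord_seq x"
  shows "\<exists>c. codes c x \<and> (\<forall>n. Ord (c n))"
proof -
  obtain \<alpha> g where x: "Ord \<alpha>" "countable (elts \<alpha>)" "\<And>\<xi>. \<xi> \<in> elts \<alpha> \<Longrightarrow> Ord (g \<xi>)" "x = seq \<alpha> g"
    using assms by (auto simp: countable_ord_seq_def)
  show ?thesis
  proof (cases "elts \<alpha> = {}")
    case True
    then have "codes (\<lambda>n. zero) x" by (auto simp: codes_def x)
    then show ?thesis by (metis Ord_zero)
  next
    case False
    then obtain f :: "nat \<Rightarrow> 'a" where f: "range f = elts \<alpha>"
      using x(2) by (metis range_from_nat_into)
    define c where "c = (\<lambda>n. if n mod 3 = 0 then zero else if n mod 3 = 1 then osucc (f (n div 3))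
      else osucc (g (f (n div 3))))"
    have c3: "c (3 * n) = zero" "c (Suc (3 * n)) = osucc (f n)" "c (Suc (Suc (3 * n))) = osucc (g (f n))" for n
    proof -
      have "3 * n mod 3 = 0" "Suc (3 * n) mod 3 = 1" "Suc (Suc (3 * n)) mod 3 = 2"
        "Suc (3 * n) div 3 = n" "Suc (Suc (3 * n)) div 3 = n" by presburger+
      then show "c (3 * n) = zero" "c (Suc (3 * n)) = osucc (f n)" "c (Suc (Suc (3 * n))) = osucc (g (f n))"
        unfolding c_def by simp_all
    qed
    have c0: "\<exists>m. n = 3 * m" if "c n = zero" for n
      using that by (auto simp: c_def split: if_splits)
    have "(\<exists>n. c n = zero \<and> c (Suc n) = osucc a \<and> c (Suc (Suc n)) = osucc b) \<longleftrightarrow>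
        (\<exists>m. a = f m \<and> b = g (f m))" for a b
      using c0 c3 by (metis osucc_inject)
    moreover have "elts x = {opair a b |a b. \<exists>m. a = f m \<and> b = g (f m)}"
      unfolding x(4) elts_seq f[symmetric] by auto
    ultimately have "codes c x" by (simp add: codes_def)
    moreover have "Ord (c n)" for n
    proof -
      have "f (n div 3) \<in> elts \<alpha>" using f by auto
      then show ?thesis unfolding c_def using x(1,3) Ord_in_Ord by auto
    qed
    ultimately show ?thesis by blast
  qed
qed

section \<open>Blocks of length \<omega> and their numbers\<close>

lemma limit_osucc_pow_mem_iff:
  "zero_or_limit \<mu> \<Longrightarrow> (osucc ^^ n) \<delta> \<in> elts \<mu> \<longleftrightarrow> \<delta> \<in> elts \<mu>"
  by (induction n) (auto simp: limit_osucc_mem_iff)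

lemma omega1_pow: "(osucc ^^ n) \<delta> \<in> elts omega1 \<longleftrightarrow> \<delta> \<in> elts omega1"
  by (induction n) (auto intro: omega1_trans)

lemma omega1_Ord: "\<eta> \<in> elts omega1 \<Longrightarrow> Ord \<eta>"
  using Ord_in_Ord omega1(1) by blast

text \<open>Two places lie in different blocks when a limit \<delta> separates them. Numbering the
  blocks by collapsing this relation avoids ordinal arithmetic and translates directly into a
  formula.\<close>

definition earlier :: "'a::zfc \<Rightarrow> 'a \<Rightarrow> 'a set" where
  "earlier \<mu> \<eta> = {\<eta>' \<in> elts \<eta> - elts \<mu>. \<exists>\<delta>. zero_or_limit \<delta> \<and> \<eta>' \<in> elts \<delta> \<and> (\<delta> \<in> elts \<eta> \<or> \<delta> = \<eta>)}"

text \<open>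
  The ordinals from the limit \<open>\<mu>\<close> on are divided into blocks of length \<open>\<omega>\<close>; the number of a block
  is the set of the numbers of the earlier ones.
\<close>

definition block :: "'a::zfc \<Rightarrow> 'a \<Rightarrow> 'a" where
  "block \<mu> = (SOME f. \<forall>\<eta>. f \<eta> = mkset (f ` earlier \<mu> \<eta>))"

lemma earlier_subset: "earlier \<mu> \<eta> \<subseteq> elts \<eta>"
  by (auto simp: earlier_def)

lemma elts_block: "elts (block \<mu> \<eta>) = block \<mu> ` earlier \<mu> \<eta>"
proof -
  have "\<exists>f::'a \<Rightarrow> 'a. \<forall>\<eta>. f \<eta> = mkset (f ` earlier \<mu> \<eta>)"
  proof (rule elts_recursion)
    fix f g :: "'a \<Rightarrow> 'a" and x assume "\<And>y. y \<in> elts x \<Longrightarrow> f y = g y"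
    then have "f ` earlier \<mu> x = g ` earlier \<mu> x" using earlier_subset by (intro image_cong) auto
    then show "mkset (f ` earlier \<mu> x) = mkset (g ` earlier \<mu> x)" by simp
  qed
  then have "\<forall>\<eta>. block \<mu> \<eta> = mkset (block \<mu> ` earlier \<mu> \<eta>)" unfolding block_def by (rule someI_ex)
  moreover have "small (block \<mu> ` earlier \<mu> \<eta>)"
    by (rule small_image, rule small_subset[OF small_elts earlier_subset])
  ultimately show ?thesis by (metis elts_mkset)
qed

lemma earlier_osucc: "earlier \<mu> (osucc \<eta>) = earlier \<mu> \<eta>"
  unfolding earlier_def by (auto dest: elts_asym)

lemma earlier_limit: "zero_or_limit \<delta> \<Longrightarrow> earlier \<mu> \<delta> = elts \<delta> - elts \<mu>"
  by (auto simp: earlier_def)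

lemma earlier_trans: "Ord \<eta> \<Longrightarrow> \<eta>' \<in> earlier \<mu> \<eta> \<Longrightarrow> \<eta>'' \<in> earlier \<mu> \<eta>' \<Longrightarrow> \<eta>'' \<in> earlier \<mu> \<eta>"
  unfolding earlier_def using Ord_trans by blast

lemma block_osucc [simp]: "block \<mu> (osucc \<eta>) = block \<mu> \<eta>"
  by (rule extensionality) (simp add: elts_block earlier_osucc)

lemma block_pow [simp]: "block \<mu> ((osucc ^^ n) \<eta>) = block \<mu> \<eta>"
  by (induction n) simp_all

lemma Ord_block: "Ord \<eta> \<Longrightarrow> Ord (block \<mu> \<eta>)"
proof (induction \<eta> rule: elts_induct)
  case (1 \<eta>)
  show ?case
  proof (rule OrdI)
    fix \<beta> assume "\<beta> \<in> elts (block \<mu> \<eta>)"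
    then obtain \<eta>' where e: "\<eta>' \<in> earlier \<mu> \<eta>" "\<beta> = block \<mu> \<eta>'" by (auto simp: elts_block)
    then have "Ord \<beta>" using 1 earlier_subset Ord_in_Ord by blast
    moreover have "elts \<beta> \<subseteq> elts (block \<mu> \<eta>)"
      using earlier_trans[OF 1(2) e(1)] by (auto simp: elts_block e(2))
    ultimately show "Ord \<beta> \<and> elts \<beta> \<subseteq> elts (block \<mu> \<eta>)" ..
  qed
qed

lemma block_in_omega1: "\<eta> \<in> elts omega1 \<Longrightarrow> block \<mu> \<eta> \<in> elts omega1"
proof (rule countable_Ord_in_omega1)
  assume a: "\<eta> \<in> elts omega1"
  then show "Ord (block \<mu> \<eta>)" by (simp add: omega1_Ord Ord_block)
  show "countable (elts (block \<mu> \<eta>))"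
    using countable_subset[OF earlier_subset omega1(3)[OF a]] by (simp add: elts_block)
qed

text \<open>Induction on \<eta>: a successor shares the number of its predecessor, and below a limit
  all places from \<mu> on belong to earlier blocks.\<close>

lemma block_mono:
  "Ord \<eta> \<Longrightarrow> \<eta>' \<in> elts \<eta> \<Longrightarrow> \<eta>' \<notin> elts \<mu> \<Longrightarrow> block \<mu> \<eta>' \<in> elts (block \<mu> \<eta>) \<or> block \<mu> \<eta>' = block \<mu> \<eta>"
proof (induction \<eta> rule: elts_induct)
  case (1 \<eta>)
  show ?case
  proof (cases "zero_or_limit \<eta>")
    case True
    then show ?thesis using 1 by (simp add: elts_block earlier_limit)
  next
    case False
    then obtain \<beta> where "\<eta> = osucc \<beta>" using 1(2) by (auto simp: zero_or_limit_def)
    then show ?thesis using 1 by (auto simp: Ord_osucc_iff)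
  qed
qed

lemma block_inj_limit:
  assumes "zero_or_limit \<delta>" "zero_or_limit \<delta>'" "\<delta> \<notin> elts \<mu>" "\<delta>' \<notin> elts \<mu>" "block \<mu> \<delta> = block \<mu> \<delta>'"
  shows "\<delta> = \<delta>'"
proof -
  have *: "block \<mu> a \<noteq> block \<mu> b" if "zero_or_limit b" "a \<in> elts b" "a \<notin> elts \<mu>" for a b
  proof -
    have "block \<mu> a \<in> elts (block \<mu> b)" using that by (simp add: elts_block earlier_limit)
    then show ?thesis using elts_irrefl by metis
  qed
  then show ?thesis using assms Ord_linear limit_Ord by metis
qed

text \<open>The members of a block number are again block numbers, so if \<xi> were missed, all
  numbers would lie below \<xi>. The limits from \<mu> on would then inject into a countable set;
  with countably many blocks, each countable, \<open>omega1\<close> would be countable.\<close>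

lemma block_onto:
  assumes mu: "zero_or_limit \<mu>" "\<mu> \<in> elts omega1" and xi: "\<xi> \<in> elts omega1"
  shows "\<exists>\<delta>\<in>elts omega1. zero_or_limit \<delta> \<and> \<delta> \<notin> elts \<mu> \<and> block \<mu> \<delta> = \<xi>"
proof (rule ccontr)
  assume no: "\<not> ?thesis"
  let ?L = "{\<delta> \<in> elts omega1 - elts \<mu>. zero_or_limit \<delta>}"
  have pow: "\<exists>\<delta>\<in>?L. \<exists>n. \<eta> = (osucc ^^ n) \<delta>" if eta: "\<eta> \<in> elts omega1" "\<eta> \<notin> elts \<mu>" for \<eta>
  proof -
    obtain \<delta> n where "zero_or_limit \<delta>" "\<eta> = (osucc ^^ n) \<delta>"
      using limit_part_exists omega1_Ord eta(1) by blast
    then show ?thesis using eta mu(1) by (auto simp: limit_osucc_pow_mem_iff omega1_pow)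
  qed
  have ne: "block \<mu> \<eta> \<noteq> \<xi>" if "\<eta> \<in> elts omega1" "\<eta> \<notin> elts \<mu>" for \<eta>
    using pow[OF that] no by auto
  have "block \<mu> \<eta> \<in> elts \<xi>" if eta: "\<eta> \<in> elts omega1" "\<eta> \<notin> elts \<mu>" for \<eta>
  proof -
    have "\<xi> \<notin> elts (block \<mu> \<eta>)"
    proof
      assume "\<xi> \<in> elts (block \<mu> \<eta>)"
      then obtain \<eta>' where "\<eta>' \<in> earlier \<mu> \<eta>" "\<xi> = block \<mu> \<eta>'" by (auto simp: elts_block)
      then show False using ne[of \<eta>'] eta omega1_trans by (auto simp: earlier_def)
    qed
    then show ?thesis using ne[OF eta] Ord_linear[OF Ord_block] omega1_Ord eta(1) xi by blast
  qed
  then have "block \<mu> ` ?L \<subseteq> elts \<xi>" by auto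
  then have "countable (block \<mu> ` ?L)" using omega1(3)[OF xi] countable_subset by blast
  moreover have "inj_on (block \<mu>) ?L" by (rule inj_onI) (use block_inj_limit in auto)
  ultimately have "countable ?L" by (rule countable_image_inj_on)
  then have "countable (elts \<mu> \<union> (\<Union>\<delta>\<in>?L. range (\<lambda>n. (osucc ^^ n) \<delta>)))"
    using omega1(3)[OF mu(2)] by (intro countable_Un countable_UN) auto
  moreover have "elts omega1 \<subseteq> elts \<mu> \<union> (\<Union>\<delta>\<in>?L. range (\<lambda>n. (osucc ^^ n) \<delta>))"
  proof
    fix \<eta> assume "\<eta> \<in> elts (omega1::'a)"
    then show "\<eta> \<in> elts \<mu> \<union> (\<Union>\<delta>\<in>?L. range (\<lambda>n. (osucc ^^ n) \<delta>))"
      using pow[of \<eta>] by blast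
  qed
  ultimately show False using omega1(2) countable_subset by blast
qed

section \<open>The places of each player inside a block\<close>

definition slots :: "'a::zfc \<Rightarrow> 'a \<Rightarrow> bool \<Rightarrow> 'a set" where
  "slots \<mu> \<xi> b = {\<eta> \<in> elts omega1 - elts \<mu>. block \<mu> \<eta> = \<xi> \<and> (first_turn \<eta> \<longleftrightarrow> b)}"

definition init_slots :: "'a::zfc \<Rightarrow> bool \<Rightarrow> 'a set" where
  "init_slots \<nu> b = {\<eta> \<in> elts \<nu>. first_turn \<eta> \<longleftrightarrow> b}"

lemma small_slots [simp]: "small (slots \<mu> \<xi> b)"
  by (rule small_subset[OF small_elts[of omega1]]) (auto simp: slots_def)

lemma small_init_slots [simp]: "small (init_slots \<nu> b)"
  by (rule small_subset[OF small_elts[of \<nu>]]) (auto simp: init_slots_def)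

lemma slots_Ord: "\<eta> \<in> slots \<mu> \<xi> b \<Longrightarrow> Ord \<eta>"
  by (auto simp: slots_def omega1_Ord)

lemma init_slots_Ord: "zero_or_limit \<nu> \<Longrightarrow> \<eta> \<in> init_slots \<nu> b \<Longrightarrow> Ord \<eta>"
  by (auto simp: init_slots_def intro: Ord_in_Ord limit_Ord)

lemma slots_two: "zero_or_limit \<mu> \<Longrightarrow> \<eta> \<in> slots \<mu> \<xi> b \<Longrightarrow> two \<eta> \<in> slots \<mu> \<xi> b"
  using first_turn_two[OF slots_Ord[of \<eta> \<mu> \<xi> b]]
  by (auto simp: slots_def limit_osucc_mem_iff two_def)

lemma init_slots_two: "zero_or_limit \<nu> \<Longrightarrow> \<eta> \<in> init_slots \<nu> b \<Longrightarrow> two \<eta> \<in> init_slots \<nu> b"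
  using first_turn_two[OF init_slots_Ord[of \<nu> \<eta> b]]
  by (auto simp: init_slots_def two_def limit_osucc_mem_iff)

lemma slot_index:
  assumes "zero_or_limit \<delta>"
  shows "\<exists>m. half ((osucc ^^ m) \<delta>) = n \<and> (first_turn ((osucc ^^ m) \<delta>) \<longleftrightarrow> b)"
proof -
  have "half ((osucc ^^ m) \<delta>) = m div 2" "first_turn ((osucc ^^ m) \<delta>) \<longleftrightarrow> even m" for m
    using assms by (simp_all add: half_def fin_part_pow first_turn_iff Ord_osucc_pow limit_Ord)
  moreover have "(if b then 2 * n else 2 * n + 1) div 2 = n" "even (if b then 2 * n else 2 * n + 1) \<longleftrightarrow> b"
    by auto
  ultimately show ?thesis by metis
qed

lemma slots_half:
  assumes "zero_or_limit \<mu>" "\<mu> \<in> elts omega1" "\<xi> \<in> elts omega1"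
  shows "\<exists>\<eta>\<in>slots \<mu> \<xi> b. half \<eta> = n"
proof -
  obtain \<delta> where d: "\<delta> \<in> elts omega1" "zero_or_limit \<delta>" "\<delta> \<notin> elts \<mu>" "block \<mu> \<delta> = \<xi>"
    using block_onto[OF assms] by blast
  obtain m where "half ((osucc ^^ m) \<delta>) = n" "first_turn ((osucc ^^ m) \<delta>) \<longleftrightarrow> b"
    using slot_index[OF d(2)] by blast
  then have "(osucc ^^ m) \<delta> \<in> slots \<mu> \<xi> b" "half ((osucc ^^ m) \<delta>) = n"
    using d assms(1) by (simp_all add: slots_def limit_osucc_pow_mem_iff omega1_pow)
  then show ?thesis by blast
qed

lemma init_slots_half:
  assumes "zero_or_limit \<nu>" "zero \<in> elts \<nu>"
  shows "\<exists>\<eta>\<in>init_slots \<nu> b. half \<eta> = n"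
proof -
  obtain m where "half ((osucc ^^ m) (zero::'a)) = n" "first_turn ((osucc ^^ m) (zero::'a)) \<longleftrightarrow> b"
    using slot_index[OF zero_or_limit_zero] by blast
  then have "(osucc ^^ m) zero \<in> init_slots \<nu> b" "half ((osucc ^^ m) (zero::'a)) = n"
    using assms by (simp_all add: init_slots_def limit_osucc_pow_mem_iff)
  then show ?thesis by blast
qed

text \<open>From \<mu> on, each move of the second player directly follows a move of the first in
  the same block.\<close>

lemma slots_False_eq:
  assumes "zero_or_limit \<mu>"
  shows "slots \<mu> \<xi> False = osucc ` slots \<mu> \<xi> True"
proof (intro set_eqI iffI)
  fix \<eta> assume e: "\<eta> \<in> slots \<mu> \<xi> False"
  then obtain \<beta> where b: "\<eta> = osucc \<beta>" "Ord \<beta>" "first_turn \<beta>"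
    using second_turn_pred[OF slots_Ord[OF e]] by (auto simp: slots_def)
  then have "\<beta> \<in> slots \<mu> \<xi> True"
    using e assms omega1_trans[of \<eta> \<beta>] by (auto simp: slots_def limit_osucc_mem_iff)
  then show "\<eta> \<in> osucc ` slots \<mu> \<xi> True" using b by blast
next
  fix \<eta> assume "\<eta> \<in> osucc ` slots \<mu> \<xi> True"
  then obtain \<beta> where "\<eta> = osucc \<beta>" "\<beta> \<in> slots \<mu> \<xi> True" by blast
  then show "\<eta> \<in> slots \<mu> \<xi> False"
    using assms slots_Ord[of \<beta> \<mu> \<xi> True] by (auto simp: slots_def limit_osucc_mem_iff first_turn_osucc)
qed

text \<open>Decoding does not notice a delay of one move, because \<open>two\<close> commutes with
  \<open>osucc\<close>.\<close>

lemma dec_shift: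
  assumes "zero_or_limit \<mu>" "\<And>\<eta>. \<eta> \<in> slots \<mu> \<xi> True \<Longrightarrow> q (osucc \<eta>) = p \<eta>"
  shows "dec q (slots \<mu> \<xi> False) = dec p (slots \<mu> \<xi> True)"
proof -
  have "triple q (osucc \<eta>) a b \<longleftrightarrow> triple p \<eta> a b" if "\<eta> \<in> slots \<mu> \<xi> True" for \<eta> a b
  proof -
    have "two (osucc \<eta>) = osucc (two \<eta>)" "two (two (osucc \<eta>)) = osucc (two (two \<eta>))"
      by (simp_all add: two_def)
    then show ?thesis using that assms slots_two[OF assms(1)] by (simp add: triple_def)
  qed
  then show ?thesis unfolding dec_def slots_False_eq[OF assms(1)]
    by (intro arg_cong[of _ _ mkset]) blast
qed

text \<open>
  In the coded game the first player first proposes a parameter and the second player a member of \<open>S\<close>,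
  by their moves below \<open>\<nu>\<close>; at \<open>\<nu> + 1\<close> the second player chooses a role; the moves in block number
  \<open>\<xi>\<close> from \<open>\<mu>\<close> on code move number \<open>\<xi>\<close> of the original game, made by the player whose role has the
  turn. The proposed member of \<open>S\<close> replaces moves that do not code a member of \<open>S\<close>.
\<close>

locale coded_game =
  fixes \<theta> S \<kappa> \<mu> \<nu> :: "'v::zfc" and As :: "'v \<Rightarrow> 'v"
  assumes theta: "elts \<theta> \<subseteq> elts omega1"
    and S_nonempty: "elts S \<noteq> {}"
    and nu: "zero_or_limit \<nu>" "zero \<in> elts \<nu>"
    and mu: "zero_or_limit \<mu>" "\<nu> \<in> elts \<mu>" "\<mu> \<in> elts omega1"
    and kappa: "zero \<in> elts \<kappa>" "osucc zero \<in> elts \<kappa>"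
    and codable: "\<And>x. x \<in> elts S \<Longrightarrow> \<exists>c. codes c x \<and> range c \<subseteq> elts \<kappa>"
begin

text \<open>True when the first player of the coded game also takes the first role in the original
  one. Any move other than \<open>zero\<close> chooses the opposite, so no choice is
  invalid.\<close>

definition role :: "('v \<Rightarrow> 'v) \<Rightarrow> bool" where
  "role p \<longleftrightarrow> p (osucc \<nu>) = zero"

text \<open>The flag \<open>first_turn \<xi> \<longleftrightarrow> role p\<close> says whether move
  \<xi> is up to the first player of the coded game; it selects the half of the block that is
  read.\<close>

definition move :: "('v \<Rightarrow> 'v) \<Rightarrow> 'v \<Rightarrow> 'v" where
  "move p \<xi> = (let d = dec p (slots \<mu> \<xi> (first_turn \<xi> \<longleftrightarrow> role p))
     in if d \<in> elts S then d else dec p (init_slots \<nu> False))"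

text \<open>A default outside \<open>S\<close> makes the implication vacuous, which is a loss for
  the second player. The equivalence gives the first player the goal that fits the role.\<close>

definition win :: "('v \<Rightarrow> 'v) \<Rightarrow> bool" where
  "win p \<longleftrightarrow> (dec p (init_slots \<nu> False) \<in> elts S \<longrightarrow>
     (role p \<longleftrightarrow> seq \<theta> (move p) \<in> elts (As (dec p (init_slots \<nu> True)))))"

definition payoff :: 'v where
  "payoff = mkset {seq omega1 p |p. p \<in> moves omega1 \<kappa> \<and> win p}"

lemma nu_omega1: "\<nu> \<in> elts omega1"
  using mu omega1_trans by blast

lemma osucc_nu: "osucc \<nu> \<in> elts \<mu>" "osucc \<nu> \<in> elts omega1"
  using mu limit_osucc_mem nu_omega1 by blast+

lemma move_cong:
  assumes "\<And>\<eta>. \<eta> \<in> elts \<nu> \<Longrightarrow> p \<eta> = q \<eta>" "p (osucc \<nu>) = q (osucc \<nu>)"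
    and "\<And>\<eta>. \<eta> \<in> slots \<mu> \<xi> (first_turn \<xi> \<longleftrightarrow> role q) \<Longrightarrow> p \<eta> = q \<eta>"
  shows "move p \<xi> = move q \<xi>"
proof -
  have "role p = role q" using assms(2) by (simp add: role_def)
  moreover have "dec p (init_slots \<nu> False) = dec q (init_slots \<nu> False)"
    by (rule dec_cong) (use init_slots_two[OF nu(1)] assms(1) in \<open>auto simp: init_slots_def\<close>)
  moreover have "dec p (slots \<mu> \<xi> (first_turn \<xi> \<longleftrightarrow> role q)) = dec q (slots \<mu> \<xi> (first_turn \<xi> \<longleftrightarrow> role q))"
    by (rule dec_cong) (use slots_two[OF mu(1)] assms(3) in auto)
  ultimately show ?thesis by (simp add: move_def Let_def)
qed

lemma win_cong:
  assumes "\<And>\<eta>. \<eta> \<in> elts omega1 \<Longrightarrow> p \<eta> = q \<eta>"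
  shows "win p \<longleftrightarrow> win q"
proof -
  have nu': "p \<eta> = q \<eta>" if "\<eta> \<in> elts \<nu>" for \<eta>
    using that assms omega1_trans nu_omega1 by blast
  have "dec p (init_slots \<nu> b) = dec q (init_slots \<nu> b)" for b
    by (rule dec_cong) (use init_slots_two[OF nu(1)] nu' in \<open>auto simp: init_slots_def\<close>)
  moreover have "role p = role q" using assms osucc_nu by (simp add: role_def)
  moreover have "move p \<xi> = move q \<xi>" for \<xi>
    by (rule move_cong) (use nu' assms osucc_nu in \<open>auto simp: slots_def\<close>)
  then have "seq \<theta> (move p) = seq \<theta> (move q)" by (intro seq_cong)
  ultimately show ?thesis by (simp add: win_def)
qed

lemma elts_payoff: "elts payoff = {seq omega1 p |p. p \<in> moves omega1 \<kappa> \<and> win p}"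
  unfolding payoff_def
proof (rule elts_mkset, rule small_subset)
  show "small {y. elts y \<subseteq> (\<Union>\<xi>\<in>elts omega1. opair \<xi> ` elts \<kappa>)}" by (intro small_Pow small_UN) auto
  show "{seq omega1 p |p. p \<in> moves omega1 \<kappa> \<and> win p} \<subseteq> {y. elts y \<subseteq> (\<Union>\<xi>\<in>elts omega1. opair \<xi> ` elts \<kappa>)}"
    by (fastforce simp: moves_def)
qed

lemma seq_in_payoff:
  assumes "p \<in> moves omega1 \<kappa>"
  shows "seq omega1 p \<in> elts payoff \<longleftrightarrow> win p"
proof -
  have "win p" if "\<forall>\<eta>\<in>elts omega1. p \<eta> = q \<eta>" "win q" for q
    using win_cong[of p q] that by blast
  then show ?thesis using assms by (auto simp: elts_payoff seq_eq_iff)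
qed

lemma game_payoff: "game omega1 \<kappa> payoff"
  using kappa omega1(1) by (auto simp: game_def elts_payoff)

text \<open>
  Two plays against the same strategy, with different roles chosen, in which the second player copies
  the moves that the strategy makes in the other play.
\<close>

lemma copying_plays:
  assumes "strategy first_turn omega1 \<kappa> \<sigma>" "range c \<subseteq> elts \<kappa>"
  shows "\<exists>p q. p \<in> moves omega1 \<kappa> \<and> q \<in> moves omega1 \<kappa> \<and>
    follows first_turn omega1 \<sigma> p \<and> follows first_turn omega1 \<sigma> q \<and>
    (\<forall>\<eta>\<in>elts \<nu>. p \<eta> = q \<eta> \<and> (\<not> first_turn \<eta> \<longrightarrow> p \<eta> = c (half \<eta>))) \<and>
    p (osucc \<nu>) = zero \<and> q (osucc \<nu>) = osucc zero \<and>
    (\<forall>\<eta>\<in>elts omega1 - elts \<mu>. first_turn \<eta> \<longrightarrow> p (osucc \<eta>) = q \<eta> \<and> q (osucc \<eta>) = p \<eta>)"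
proof -
  \<comment> \<open>Both plays come from one recursion into pairs, as each answer in one play is the
    preceding move of the strategy in the other. The test
    \<open>inv osucc \<eta> \<in> elts \<eta>\<close> ensures that \<open>H\<close> consults only
    members of \<eta>, as \<open>elts_recursion\<close> demands.\<close>
  define H where "H P \<eta> = (if first_turn \<eta> then (\<sigma> (seq \<eta> (fst \<circ> P)), \<sigma> (seq \<eta> (snd \<circ> P)))
     else if \<eta> \<in> elts \<nu> then (c (half \<eta>), c (half \<eta>))
     else if \<eta> = osucc \<nu> then (zero, osucc zero)
     else if inv osucc \<eta> \<in> elts \<eta> then (snd (P (inv osucc \<eta>)), fst (P (inv osucc \<eta>)))
     else (zero, zero))" for P :: "'v \<Rightarrow> 'v \<times> 'v" and \<eta>
  have "\<exists>P. \<forall>\<eta>. P \<eta> = H P \<eta>"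
  proof (rule elts_recursion)
    fix f g :: "'v \<Rightarrow> 'v \<times> 'v" and x assume fg: "\<And>y. y \<in> elts x \<Longrightarrow> f y = g y"
    then have "seq x (fst \<circ> f) = seq x (fst \<circ> g)" "seq x (snd \<circ> f) = seq x (snd \<circ> g)"
      by (auto intro!: seq_cong)
    then show "H f x = H g x" unfolding H_def using fg by auto
  qed
  then obtain P where P: "\<And>\<eta>. P \<eta> = H P \<eta>" by blast
  define p q where "p = fst \<circ> P" and "q = snd \<circ> P"
  have turn1: "p \<eta> = \<sigma> (seq \<eta> p)" "q \<eta> = \<sigma> (seq \<eta> q)" if "first_turn \<eta>" for \<eta>
    using that by (simp_all add: p_def q_def, subst P, simp add: H_def, subst P, simp add: H_def)
  have init: "p \<eta> = c (half \<eta>)" "q \<eta> = c (half \<eta>)" if "\<eta> \<in> elts \<nu>" "\<not> first_turn \<eta>" for \<eta>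
    using that by (simp_all add: p_def q_def P[of \<eta>] H_def)
  have nu2: "\<not> first_turn (osucc \<nu>)" "osucc \<nu> \<notin> elts \<nu>"
    using nu(1) by (auto simp: first_turn_osucc limit_Ord first_turn_limit dest: elts_asym)
  then have rl: "p (osucc \<nu>) = zero" "q (osucc \<nu>) = osucc zero"
    by (simp_all add: p_def q_def P[of "osucc \<nu>"] H_def)
  have inv: "inv osucc (osucc \<eta>) = \<eta>" for \<eta> :: 'v by (rule inv_f_f) (simp add: inj_def)
  have copy: "p (osucc \<eta>) = q \<eta>" "q (osucc \<eta>) = p \<eta>"
    if "\<not> first_turn (osucc \<eta>)" "osucc \<eta> \<notin> elts \<nu>" "\<eta> \<noteq> \<nu>" for \<eta>
    using that by (simp_all add: p_def q_def P[of "osucc \<eta>"] H_def inv)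
  have "p \<eta> \<in> elts \<kappa> \<and> q \<eta> \<in> elts \<kappa>" if "\<eta> \<in> elts omega1" for \<eta>
    using that
  proof (induction \<eta> rule: elts_induct)
    case (1 \<eta>)
    have sub: "p \<in> moves \<eta> \<kappa>" "q \<in> moves \<eta> \<kappa>"
      using 1 omega1_trans by (auto simp: moves_def)
    show ?case
    proof (cases "first_turn \<eta>")
      case True
      then show ?thesis using turn1[OF True] sub assms(1) 1(2) by (auto simp: strategy_def)
    next
      case False
      then obtain \<beta> where "\<eta> = osucc \<beta>" using second_turn_pred omega1_Ord 1(2) by blast
      then show ?thesis using init[of \<eta>] rl copy[of \<beta>] False kappa assms(2) 1 omega1_trans[of \<eta> \<beta>]
        by (cases "\<eta> \<in> elts \<nu>"; cases "\<beta> = \<nu>") auto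
    qed
  qed
  then have "p \<in> moves omega1 \<kappa>" "q \<in> moves omega1 \<kappa>" by (auto simp: moves_def)
  moreover have "p \<eta> = q \<eta>" if "\<eta> \<in> elts \<nu>" for \<eta>
    using that
  proof (induction \<eta> rule: elts_induct)
    case (1 \<eta>)
    have "seq \<eta> p = seq \<eta> q" by (rule seq_cong) (use 1 Ord_trans limit_Ord nu(1) in blast)
    then show ?case using turn1[of \<eta>] init[of \<eta>] 1(2) by (cases "first_turn \<eta>") auto
  qed
  moreover have "p (osucc \<eta>) = q \<eta> \<and> q (osucc \<eta>) = p \<eta>"
    if "\<eta> \<in> elts omega1" "\<eta> \<notin> elts \<mu>" "first_turn \<eta>" for \<eta>
  proof -
    have "\<not> first_turn (osucc \<eta>)" using that by (simp add: first_turn_osucc omega1_Ord)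
    moreover have "osucc \<eta> \<notin> elts \<nu>"
      using that(2) mu Ord_trans[OF limit_Ord] limit_osucc_mem_iff[OF nu(1)] by blast
    moreover have "\<eta> \<noteq> \<nu>" using that(2) mu(2) by blast
    ultimately show ?thesis using copy by blast
  qed
  ultimately show ?thesis using turn1 init rl unfolding follows_def
    by (intro exI[of _ p] exI[of _ q]) auto
qed

text \<open>The strategy has the first role in \<open>p\<close> and the second in \<open>q\<close>.
  In each block the half read in one play agrees, up to the delay, with the half read in the other,
  so both decode to one play of the same \<open>As s'\<close>. Two wins would put it both inside and
  outside the payoff.\<close>

lemma first_cannot_win: "\<not> first_wins_by omega1 \<kappa> payoff \<sigma>"
proof
  assume s: "first_wins_by omega1 \<kappa> payoff \<sigma>"
  obtain x where x: "x \<in> elts S" using S_nonempty by blast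
  obtain c where c: "codes c x" "range c \<subseteq> elts \<kappa>" using codable[OF x] by blast
  obtain p q where pq: "p \<in> moves omega1 \<kappa>" "q \<in> moves omega1 \<kappa>"
    "follows first_turn omega1 \<sigma> p" "follows first_turn omega1 \<sigma> q"
    "\<And>\<eta>. \<eta> \<in> elts \<nu> \<Longrightarrow> p \<eta> = q \<eta>"
    "\<And>\<eta>. \<eta> \<in> elts \<nu> \<Longrightarrow> \<not> first_turn \<eta> \<Longrightarrow> p \<eta> = c (half \<eta>)"
    "p (osucc \<nu>) = zero" "q (osucc \<nu>) = osucc zero"
    "\<And>\<eta>. \<eta> \<in> elts omega1 - elts \<mu> \<Longrightarrow> first_turn \<eta> \<Longrightarrow> p (osucc \<eta>) = q \<eta> \<and> q (osucc \<eta>) = p \<eta>"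
    using copying_plays[of \<sigma> c] s c(2) unfolding first_wins_by_def by metis
  have win: "win p" "win q" using s pq(1-4) seq_in_payoff by (auto simp: first_wins_by_def)
  have init: "dec p (init_slots \<nu> b) = dec q (init_slots \<nu> b)" for b
    by (rule dec_cong) (use init_slots_two[OF nu(1)] pq(5) in \<open>auto simp: init_slots_def\<close>)
  have x0: "dec p (init_slots \<nu> False) = x"
    by (rule dec_codes[OF small_init_slots _ _ _ init_slots_half[OF nu] c(1)])
      (use init_slots_two[OF nu(1)] init_slots_Ord[OF nu(1)] pq(6) in \<open>auto simp: init_slots_def\<close>)
  have role: "role p" "\<not> role q" using pq(7,8) by (simp_all add: role_def)
  have "dec p (slots \<mu> \<xi> b) = dec q (slots \<mu> \<xi> (\<not> b))" for \<xi> b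
    using dec_shift[OF mu(1), of \<xi> p q] dec_shift[OF mu(1), of \<xi> q p] pq(9)
    by (cases b) (auto simp: slots_def)
  then have "move p \<xi> = move q \<xi>" for \<xi> using init role by (simp add: move_def Let_def)
  then have "seq \<theta> (move p) = seq \<theta> (move q)" by (intro seq_cong)
  then show False using win role init x0 x by (simp add: win_def)
qed

text \<open>The first player's moves are prescribed by place, whatever the answers. The parameter
  \<open>g\<close> turns this into one function \<open>p\<close> for a whole family of
  prescriptions.\<close>

lemma second_response:
  fixes a :: "('v \<Rightarrow> 'v) \<Rightarrow> 'v \<Rightarrow> 'v"
  assumes "second_wins_by omega1 \<kappa> payoff \<tau>"
  shows "\<exists>p. \<forall>g. (\<forall>\<eta>. p g \<eta> = (if first_turn \<eta> then a g \<eta> else \<tau> (seq \<eta> (p g)))) \<and>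
    ((\<forall>\<eta>. a g \<eta> \<in> elts \<kappa>) \<longrightarrow> p g \<in> moves omega1 \<kappa> \<and> \<not> win (p g))"
proof -
  have "\<exists>f. (\<forall>\<eta>. f \<eta> = (if first_turn \<eta> then a g \<eta> else \<tau> (seq \<eta> f))) \<and>
    ((\<forall>\<eta>. a g \<eta> \<in> elts \<kappa>) \<longrightarrow> f \<in> moves omega1 \<kappa> \<and> \<not> win f)" for g
  proof -
    have "\<exists>f. \<forall>\<eta>. f \<eta> = (if first_turn \<eta> then a g \<eta> else \<tau> (seq \<eta> f))"
      by (rule elts_recursion) (simp cong: seq_cong)
    then obtain f where f: "\<And>\<eta>. f \<eta> = (if first_turn \<eta> then a g \<eta> else \<tau> (seq \<eta> f))" by blast
    have "f \<in> moves omega1 \<kappa> \<and> \<not> win f" if a: "\<And>\<eta>. a g \<eta> \<in> elts \<kappa>"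
    proof -
      have "f \<eta> \<in> elts \<kappa>" if "\<eta> \<in> elts omega1" for \<eta>
        using that
      proof (induction \<eta> rule: elts_induct)
        case (1 \<eta>)
        have "f \<in> moves \<eta> \<kappa>" using 1 omega1_trans by (auto simp: moves_def)
        then show ?case
          using a f[of \<eta>] assms 1(2) second_turn_iff[OF omega1_Ord[OF 1(2)]]
          by (auto simp: second_wins_by_def strategy_def)
      qed
      then have m: "f \<in> moves omega1 \<kappa>" by (simp add: moves_def)
      have "follows second_turn omega1 \<tau> f"
        unfolding follows_def using f second_turn_iff omega1_Ord by metis
      then show ?thesis using m assms seq_in_payoff by (auto simp: second_wins_by_def)
    qed
    then show ?thesis using f by blast
  qed
  then show ?thesis by metis
qed

text \<open>Here \<open>g\<close> is a play of the original game in progress. The first player of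
  the coded game enters \<open>s\<close> and then codes the moves of \<open>g\<close> that belong to
  the role left over by \<tau>; the decoded answers of \<tau> are the strategy for the other
  role.\<close>

lemma determined_of_second:
  assumes tau: "second_wins_by omega1 \<kappa> payoff \<tau>"
    and cs: "codes cs s" "range cs \<subseteq> elts \<kappa>"
  shows "determined \<theta> S (As s)"
proof -
  obtain x\<^sub>0 where x\<^sub>0: "x\<^sub>0 \<in> elts S" using S_nonempty by blast
  obtain enc where enc: "\<And>x. x \<in> elts S \<Longrightarrow> codes (enc x) x" "\<And>x. x \<in> elts S \<Longrightarrow> range (enc x) \<subseteq> elts \<kappa>"
    using codable by metis
  \<comment> \<open>Of the first player's moves below \<mu>, only those below \<nu> are decoded.
    From \<mu> on, \<open>zero\<close> fills the places where that player has nothing to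
    code.\<close>
  define a where "a r g \<eta> = (if \<eta> \<in> elts \<mu> then cs (half \<eta>)
     else if block \<mu> \<eta> \<in> elts \<theta> \<and> g (block \<mu> \<eta>) \<in> elts S \<and> (first_turn (block \<mu> \<eta>) \<longleftrightarrow> r)
     then enc (g (block \<mu> \<eta>)) (half \<eta>) else zero)" for r g \<eta>
  have a_kappa: "a r g \<eta> \<in> elts \<kappa>" for r g \<eta>
    unfolding a_def using cs(2) enc(2)[of "g (block \<mu> \<eta>)"] kappa by auto
  have "\<exists>p. \<forall>g. (\<forall>\<eta>. p g \<eta> = (if first_turn \<eta> then a r g \<eta> else \<tau> (seq \<eta> (p g)))) \<and>
      p g \<in> moves omega1 \<kappa> \<and> \<not> win (p g)" for r
    using second_response[OF tau, of "a r"] a_kappa by blast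
  then obtain P where P: "\<And>r g \<eta>. P r g \<eta> = (if first_turn \<eta> then a r g \<eta> else \<tau> (seq \<eta> (P r g)))"
      "\<And>r g. P r g \<in> moves omega1 \<kappa>" "\<And>r g. \<not> win (P r g)" by metis
  have P_mu: "P r g \<eta> = P r' g' \<eta>" if "\<eta> \<in> elts \<mu>" for r g r' g' \<eta>
    using that
  proof (induction \<eta> rule: elts_induct)
    case (1 \<eta>)
    have "seq \<eta> (P r g) = seq \<eta> (P r' g')" by (rule seq_cong) (use 1 Ord_trans limit_Ord mu(1) in blast)
    then show ?case unfolding P(1)[of r g \<eta>] P(1)[of r' g' \<eta>] a_def using 1(2) by simp
  qed
  \<comment> \<open>By \<open>P_mu\<close> the plays below \<mu> depend on neither \<open>r\<close>
    nor \<open>g\<close>. So the role that \<tau> chooses can be read off an arbitrary play and only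
    then be inserted for \<open>r\<close>.\<close>
  define r where "r = role (P True (\<lambda>_. x\<^sub>0))"
  define p where "p = P r"
  note p_eq = P(1)[of r, folded p_def]
  have role: "role (p g) = r" for g
    unfolding r_def role_def p_def using P_mu[OF osucc_nu(1)] by metis
  have not_win: "\<not> win (p g)" for g using P(3) by (simp add: p_def)
  have nu_mu: "\<eta> \<in> elts \<mu>" if "\<eta> \<in> elts \<nu>" for \<eta> using that mu Ord_trans limit_Ord by blast
  have s_eq: "dec (p g) (init_slots \<nu> True) = s" for g
  proof (rule dec_codes[OF small_init_slots _ _ _ init_slots_half[OF nu] cs(1)])
    fix \<eta> assume "\<eta> \<in> init_slots \<nu> True"
    then show "p g \<eta> = cs (half \<eta>)" by (simp add: init_slots_def p_eq[of g \<eta>] a_def nu_mu)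
  qed (use init_slots_two[OF nu(1)] init_slots_Ord[OF nu(1)] in auto)
  have default: "dec (p g) (init_slots \<nu> False) \<in> elts S"
    and not_win': "role (p g) \<noteq> (seq \<theta> (move (p g)) \<in> elts (As s))" for g
    using not_win[of g] s_eq[of g] by (auto simp: win_def)
  have move_S: "move (p g) \<xi> \<in> elts S" for g \<xi> using default by (simp add: move_def Let_def)
  have move_other: "move (p g) \<xi> = g \<xi>"
    if xi: "\<xi> \<in> elts \<theta>" "first_turn \<xi> \<longleftrightarrow> r" and g: "g \<xi> \<in> elts S" for g \<xi>
  proof -
    have xi1: "\<xi> \<in> elts omega1" using theta xi(1) by blast
    have "dec (p g) (slots \<mu> \<xi> True) = g \<xi>"
    proof (rule dec_codes[OF small_slots _ _ _ slots_half[OF mu(1,3) xi1] enc(1)[OF g]])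
      fix \<eta> assume "\<eta> \<in> slots \<mu> \<xi> True"
      then show "p g \<eta> = enc (g \<xi>) (half \<eta>)" using xi g by (auto simp: slots_def p_eq[of g \<eta>] a_def)
    qed (use slots_two[OF mu(1)] slots_Ord in auto)
    then show ?thesis using xi(2) g by (simp add: move_def role)
  qed
  have move_local: "move (p g) \<xi> = move (p g') \<xi>"
    if xi: "first_turn \<xi> \<longleftrightarrow> \<not> r" and eq: "\<And>\<zeta>. \<zeta> \<in> elts \<xi> \<Longrightarrow> g \<zeta> = g' \<zeta>" for g g' \<xi>
  proof (rule move_cong)
    show "p g \<eta> = p g' \<eta>" if "\<eta> \<in> elts \<nu>" for \<eta> using P_mu[OF nu_mu[OF that]] by (simp add: p_def)
    show "p g (osucc \<nu>) = p g' (osucc \<nu>)" using P_mu[OF osucc_nu(1)] by (simp add: p_def)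
    \<comment> \<open>The plays agree up to the end of block \<xi>: so far \<open>a\<close> has
      consulted \<open>g\<close> only at numbers below \<xi>, and not at \<xi> itself, where the
      turn belongs to the other role.\<close>
    have "p g \<eta> = p g' \<eta>"
      if "\<eta> \<in> elts omega1" "\<eta> \<notin> elts \<mu> \<Longrightarrow> block \<mu> \<eta> \<in> elts \<xi> \<or> block \<mu> \<eta> = \<xi>" "Ord \<xi>" for \<eta>
      using that
    proof (induction \<eta> rule: elts_induct)
      case (1 \<eta>)
      have "p g \<zeta> = p g' \<zeta>" if z: "\<zeta> \<in> elts \<eta>" for \<zeta>
      proof (rule 1(1)[OF z _ _ 1(4)])
        show "\<zeta> \<in> elts omega1" using z 1(2) omega1_trans by blast
        assume zm: "\<zeta> \<notin> elts \<mu>"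
        then have "\<eta> \<notin> elts \<mu>" using z mu(1) Ord_trans limit_Ord by blast
        then show "block \<mu> \<zeta> \<in> elts \<xi> \<or> block \<mu> \<zeta> = \<xi>"
          using 1(3) block_mono[OF omega1_Ord[OF 1(2)] z zm] Ord_trans[OF 1(4)] by metis
      qed
      then have "seq \<eta> (p g) = seq \<eta> (p g')" by (rule seq_cong)
      moreover have "a r g \<eta> = a r g' \<eta>" using 1(3) eq xi by (auto simp: a_def)
      ultimately show ?case by (simp add: p_eq[of _ \<eta>])
    qed
    then show "p g \<eta> = p g' \<eta>" if "\<eta> \<in> slots \<mu> \<xi> (first_turn \<xi> \<longleftrightarrow> role (p g'))" for \<eta>
      using that Ord_block omega1_Ord by (auto simp: slots_def)
  qed
  \<comment> \<open>A position determines \<xi> and the values of \<open>g\<close> below \<xi>; by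
    \<open>move_local\<close> these determine the decoded answer, so the choice is unambiguous where
    \<sigma> is to move.\<close>
  define \<sigma> where "\<sigma> y = (SOME z. \<exists>\<xi> g. y = seq \<xi> g \<and> z = move (p g) \<xi>)" for y
  have sigma: "\<sigma> (seq \<xi> g) = move (p g) \<xi>" if "first_turn \<xi> \<longleftrightarrow> \<not> r" for \<xi> g
    unfolding \<sigma>_def
  proof (rule some_equality)
    fix z assume "\<exists>\<xi>' g'. seq \<xi> g = seq \<xi>' g' \<and> z = move (p g') \<xi>'"
    then obtain g' where "\<And>\<zeta>. \<zeta> \<in> elts \<xi> \<Longrightarrow> g' \<zeta> = g \<zeta>" "z = move (p g') \<xi>"
      by (metis seq_eq_iff)
    then show "z = move (p g) \<xi>" using move_local[OF that, of g' g] by simp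
  qed blast
  \<comment> \<open>A play that follows \<sigma> is a fixed point: encoding its moves of role
    \<open>r\<close> and decoding the result gives it back.\<close>
  have follow: "seq \<theta> g = seq \<theta> (move (p g))"
    if g: "g \<in> moves \<theta> S" and f: "\<And>\<xi>. \<xi> \<in> elts \<theta> \<Longrightarrow> (first_turn \<xi> \<longleftrightarrow> \<not> r) \<Longrightarrow> g \<xi> = \<sigma> (seq \<xi> g)" for g
  proof (rule seq_cong)
    fix \<xi> assume xi: "\<xi> \<in> elts \<theta>"
    then show "g \<xi> = move (p g) \<xi>"
      using move_other[OF xi, of g] f[OF xi] sigma[of \<xi> g] g
      by (cases "first_turn \<xi> \<longleftrightarrow> r") (auto simp: moves_def)
  qed
  have second: "second_turn \<xi> \<longleftrightarrow> \<not> first_turn \<xi>" if "\<xi> \<in> elts \<theta>" for \<xi>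
    using that theta second_turn_iff omega1_Ord by blast
  show ?thesis
  proof (cases r)
    case True
    have "second_wins_by \<theta> S (As s) \<sigma>"
      unfolding second_wins_by_def strategy_def follows_def
      using True second sigma move_S follow not_win' role by auto
    then show ?thesis by (auto simp: determined_def)
  next
    case False
    have "first_wins_by \<theta> S (As s) \<sigma>"
      unfolding first_wins_by_def strategy_def follows_def
      using False sigma move_S follow not_win' role by auto
    then show ?thesis by (auto simp: determined_def)
  qed
qed

lemma determined_original:
  "determined omega1 \<kappa> payoff \<Longrightarrow> codes c s \<Longrightarrow> range c \<subseteq> elts \<kappa> \<Longrightarrow> determined \<theta> S (As s)"
  using first_cannot_win determined_of_second unfolding determined_def[of omega1] by blast

end

section \<open>The cumulative hierarchy\<close>

lemma mem_Vlevel: "x \<in> Vlevel \<alpha> \<longleftrightarrow> (\<exists>\<beta>\<in>elts \<alpha>. elts x \<subseteq> Vlevel \<beta>)"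
  by (subst Vlevel.simps) auto

lemma Vlevel_mono: "elts \<alpha> \<subseteq> elts \<beta> \<Longrightarrow> Vlevel \<alpha> \<subseteq> Vlevel \<beta>"
  by (rule subsetI, unfold mem_Vlevel) blast

lemma Vlevel_mono_Ord: "Ord \<beta> \<Longrightarrow> \<alpha> \<in> elts \<beta> \<Longrightarrow> Vlevel \<alpha> \<subseteq> Vlevel \<beta>"
  by (intro Vlevel_mono) (auto intro: Ord_trans)

lemma Vlevel_trans: "Ord \<alpha> \<Longrightarrow> x \<in> Vlevel \<alpha> \<Longrightarrow> y \<in> elts x \<Longrightarrow> y \<in> Vlevel \<alpha>"
  unfolding mem_Vlevel[of x] using Vlevel_mono_Ord by blast

lemma Vlevel_subset: "x \<in> Vlevel \<alpha> \<Longrightarrow> elts y \<subseteq> elts x \<Longrightarrow> y \<in> Vlevel \<alpha>"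
  unfolding mem_Vlevel by blast

lemma small_Vlevel [simp]: "small (Vlevel \<alpha>)"
proof (induction \<alpha> rule: elts_induct)
  case (1 \<alpha>)
  then show ?case by (subst Vlevel.simps) (intro small_UN small_Pow small_elts)
qed

lemma Ord_mem_Vlevel: "Ord \<alpha> \<Longrightarrow> Ord \<beta> \<Longrightarrow> \<beta> \<in> Vlevel \<alpha> \<longleftrightarrow> \<beta> \<in> elts \<alpha>"
proof
  have sub: "elts \<gamma> \<subseteq> Vlevel \<gamma>" if "Ord \<gamma>" for \<gamma> :: 'a
    using that
  proof (induction \<gamma> rule: elts_induct)
    case (1 \<gamma>)
    then show ?case using Ord_in_Ord by (force simp: mem_Vlevel[of _ \<gamma>])
  qed
  have not: "\<gamma> \<notin> Vlevel \<gamma>" if "Ord \<gamma>" for \<gamma> :: 'a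
    using that
  proof (induction \<gamma> rule: elts_induct)
    case (1 \<gamma>)
    then show ?case using Ord_in_Ord by (force simp: mem_Vlevel[of _ \<gamma>])
  qed
  assume ord: "Ord \<alpha>" "Ord \<beta>"
  show "\<beta> \<in> Vlevel \<alpha>" if "\<beta> \<in> elts \<alpha>" using sub[OF ord(1)] that by blast
  show "\<beta> \<in> elts \<alpha>" if "\<beta> \<in> Vlevel \<alpha>"
    using Ord_linear[OF ord(2,1)] not[OF ord(2)] not[OF ord(1)] that Vlevel_trans[OF ord(1) that] by blast
qed

text \<open>Levels that are recognised by their structure come with an arbitrary set as index, since
  \<open>Vlevel\<close> is defined at every set. The ordinal is the supremum of the successors of
  those found for the members of \<open>c\<close>.\<close>

lemma Vlevel_eq_Ord: "\<exists>\<gamma>. Ord \<gamma> \<and> Vlevel \<gamma> = Vlevel c"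
proof (induction c rule: elts_induct)
  case (1 c)
  then obtain f where f: "\<And>d. d \<in> elts c \<Longrightarrow> Ord (f d) \<and> Vlevel (f d) = Vlevel d" by metis
  let ?g = "mkset (\<Union>d\<in>elts c. elts (osucc (f d)))"
  have g: "Ord ?g" "elts ?g = (\<Union>d\<in>elts c. elts (osucc (f d)))"
    using Ord_UN_osucc[of "elts c" f] f by auto
  have "x \<in> Vlevel ?g \<longleftrightarrow> x \<in> Vlevel c" for x
  proof
    assume "x \<in> Vlevel ?g"
    then obtain d \<beta> where "d \<in> elts c" "\<beta> = f d \<or> \<beta> \<in> elts (f d)" "elts x \<subseteq> Vlevel \<beta>"
      unfolding mem_Vlevel g(2) by auto
    then have "elts x \<subseteq> Vlevel d" using f Vlevel_mono_Ord by blast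
    then show "x \<in> Vlevel c" using \<open>d \<in> elts c\<close> by (auto simp: mem_Vlevel)
  next
    assume "x \<in> Vlevel c"
    then obtain d where "d \<in> elts c" "elts x \<subseteq> Vlevel d" by (auto simp: mem_Vlevel)
    then show "x \<in> Vlevel ?g" unfolding mem_Vlevel g(2) using f by force
  qed
  then show ?case using g(1) by blast
qed

lemma Vlevel_exists: "\<exists>\<alpha>. Ord \<alpha> \<and> x \<in> Vlevel \<alpha>"
proof (induction x rule: elts_induct)
  case (1 x)
  then obtain f where f: "\<And>y. y \<in> elts x \<Longrightarrow> Ord (f y) \<and> y \<in> Vlevel (f y)" by metis
  let ?g = "mkset (\<Union>y\<in>elts x. elts (osucc (f y)))"
  have g: "Ord ?g" "elts ?g = (\<Union>y\<in>elts x. elts (osucc (f y)))"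
    using Ord_UN_osucc[of "elts x" f] f by auto
  have "elts x \<subseteq> Vlevel ?g"
  proof
    fix y assume y: "y \<in> elts x"
    then have "f y \<in> elts ?g" unfolding g(2) by auto
    then show "y \<in> Vlevel ?g" using f[OF y] Vlevel_mono_Ord[OF g(1)] by blast
  qed
  then have "x \<in> Vlevel (osucc ?g)" by (auto simp: mem_Vlevel)
  then show ?case using g(1) by blast
qed

lemma limit_Vlevel_exists:
  assumes "small X"
  shows "\<exists>\<delta>. zero_or_limit \<delta> \<and> X \<subseteq> Vlevel \<delta>"
proof -
  obtain \<alpha> where a: "Ord \<alpha>" "mkset X \<in> Vlevel \<alpha>" using Vlevel_exists by blast
  obtain \<delta> where d: "zero_or_limit \<delta>" "\<alpha> \<in> elts \<delta>" using limit_above[OF a(1)] by blast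
  have "X \<subseteq> Vlevel \<alpha>" using Vlevel_trans[OF a] assms by auto
  then show ?thesis using d Vlevel_mono_Ord limit_Ord by blast
qed

lemma osucc_in_Vlevel:
  assumes "zero_or_limit \<delta>" "x \<in> Vlevel \<delta>"
  shows "osucc x \<in> Vlevel \<delta>"
proof -
  obtain \<beta> where b: "\<beta> \<in> elts \<delta>" "elts x \<subseteq> Vlevel \<beta>" using assms(2) mem_Vlevel by blast
  have "Ord (osucc \<beta>)" using b(1) assms(1) Ord_in_Ord limit_Ord by blast
  then have "Vlevel \<beta> \<subseteq> Vlevel (osucc \<beta>)" by (rule Vlevel_mono_Ord) simp
  moreover have "x \<in> Vlevel (osucc \<beta>)" using b(2) by (auto simp: mem_Vlevel)
  ultimately have "elts (osucc x) \<subseteq> Vlevel (osucc \<beta>)" using b(2) by auto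
  moreover have "osucc \<beta> \<in> elts \<delta>" using assms(1) b(1) by (rule limit_osucc_mem)
  ultimately show ?thesis unfolding mem_Vlevel[of "osucc x"] by blast
qed

section \<open>Definable predicates\<close>

text \<open>Definability is handled semantically: closure rules yield the existence of a formula
  from the shape of a HOL predicate, so no formula has to be written out for the game.\<close>

definition Dfn :: "'a::zfc set \<Rightarrow> ((nat \<Rightarrow> 'a) \<Rightarrow> bool) \<Rightarrow> bool" where
  "Dfn M P \<longleftrightarrow> (\<exists>\<phi>. \<forall>e. range e \<subseteq> M \<longrightarrow> (sat M \<phi> e \<longleftrightarrow> P e))"

lemma DfnI: "(\<And>e. range e \<subseteq> M \<Longrightarrow> sat M \<phi> e \<longleftrightarrow> P e) \<Longrightarrow> Dfn M P"
  by (auto simp: Dfn_def)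

lemma Dfn_iff: "Dfn M Q \<Longrightarrow> (\<And>e. range e \<subseteq> M \<Longrightarrow> P e \<longleftrightarrow> Q e) \<Longrightarrow> Dfn M P"
  by (auto simp: Dfn_def)

lemma Dfn_mem: "Dfn M (\<lambda>e. e i \<in> elts (e j))"
  by (rule DfnI[where \<phi> = "Mem i j"]) simp

lemma Dfn_eq: "Dfn M (\<lambda>e. e i = e j)"
  by (rule DfnI[where \<phi> = "Eq i j"]) simp

lemma Dfn_not: "Dfn M P \<Longrightarrow> Dfn M (\<lambda>e. \<not> P e)"
proof -
  assume "Dfn M P"
  then obtain \<phi> where "\<And>e. range e \<subseteq> M \<Longrightarrow> sat M \<phi> e \<longleftrightarrow> P e" by (auto simp: Dfn_def)
  then show ?thesis by (intro DfnI[where \<phi> = "Neg \<phi>"]) simp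
qed

lemma Dfn_conj: "Dfn M P \<Longrightarrow> Dfn M Q \<Longrightarrow> Dfn M (\<lambda>e. P e \<and> Q e)"
proof -
  assume "Dfn M P" "Dfn M Q"
  then obtain \<phi> \<psi> where "\<And>e. range e \<subseteq> M \<Longrightarrow> sat M \<phi> e \<longleftrightarrow> P e"
    "\<And>e. range e \<subseteq> M \<Longrightarrow> sat M \<psi> e \<longleftrightarrow> Q e" unfolding Dfn_def by metis
  then show ?thesis by (intro DfnI[where \<phi> = "Conj \<phi> \<psi>"]) simp
qed

lemma Dfn_disj: "Dfn M P \<Longrightarrow> Dfn M Q \<Longrightarrow> Dfn M (\<lambda>e. P e \<or> Q e)"
  by (rule Dfn_iff[OF Dfn_not[OF Dfn_conj[OF Dfn_not Dfn_not]]]) auto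

lemma Dfn_imp: "Dfn M P \<Longrightarrow> Dfn M Q \<Longrightarrow> Dfn M (\<lambda>e. P e \<longrightarrow> Q e)"
  by (rule Dfn_iff[OF Dfn_disj[OF Dfn_not]]) auto

lemma Dfn_equiv: "Dfn M P \<Longrightarrow> Dfn M Q \<Longrightarrow> Dfn M (\<lambda>e. P e \<longleftrightarrow> Q e)"
  by (rule Dfn_iff[where Q = "\<lambda>e. (P e \<longrightarrow> Q e) \<and> (Q e \<longrightarrow> P e)"]) (auto intro: Dfn_conj Dfn_imp)

text \<open>The first premise is freshness of \<open>k\<close> in semantic form; it allows
  \<open>k\<close> to serve as the bound variable.\<close>

lemma Dfn_all:
  assumes "\<And>e v x. P (e(k := v)) x = P e x" "Dfn M (\<lambda>e. P e (e k))"
  shows "Dfn M (\<lambda>e. \<forall>x\<in>M. P e x)"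
proof -
  obtain \<phi> where phi: "\<And>e. range e \<subseteq> M \<Longrightarrow> sat M \<phi> e \<longleftrightarrow> P e (e k)"
    using assms(2) by (auto simp: Dfn_def)
  show ?thesis
  proof (rule DfnI[where \<phi> = "Forall k \<phi>"])
    fix e :: "nat \<Rightarrow> 'a" assume "range e \<subseteq> M"
    then have "range (e(k := x)) \<subseteq> M" if "x \<in> M" for x using that by auto
    then show "sat M (Forall k \<phi>) e \<longleftrightarrow> (\<forall>x\<in>M. P e x)" using phi assms(1) by simp
  qed
qed

lemma Dfn_ex:
  assumes "\<And>e v x. P (e(k := v)) x = P e x" "Dfn M (\<lambda>e. P e (e k))"
  shows "Dfn M (\<lambda>e. \<exists>x\<in>M. P e x)"
proof (rule Dfn_iff)
  show "Dfn M (\<lambda>e. \<not> (\<forall>x\<in>M. \<not> P e x))"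
    by (rule Dfn_not, rule Dfn_all[where k = k], simp add: assms(1), rule Dfn_not, rule assms(2))
qed auto

text \<open>Renaming could capture variables, so at each quantifier the bound one is sent to some
  \<open>m\<close> outside the range of \<rho>. Infinitely many must be available because every
  nested quantifier consumes one.\<close>

lemma Dfn_rename:
  assumes "Dfn M P" "infinite (- range \<rho>)"
  shows "Dfn M (\<lambda>e. P (\<lambda>n. e (\<rho> n)))"
proof -
  have *: "Dfn M (\<lambda>e. sat M \<phi> (\<lambda>n. e (\<rho> n)))" if "infinite (- range \<rho>)" for \<phi> \<rho>
    using that
  proof (induction \<phi> arbitrary: \<rho>)
    case (Forall i \<phi>)
    then obtain m where m: "m \<notin> range \<rho>" by (metis ComplD finite.emptyI infinite_super subsetI)
    have upd: "(\<lambda>n. (e(m := v)) (\<rho> n)) = (\<lambda>n. e (\<rho> n))" for e :: "nat \<Rightarrow> 'a" and v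
      using m by (auto simp: fun_eq_iff)
    have "infinite (- range (\<rho>(i := m)))"
    proof
      assume "finite (- range (\<rho>(i := m)))"
      then have "finite (insert m (- range (\<rho>(i := m))))" by simp
      moreover have "- range \<rho> \<subseteq> insert m (- range (\<rho>(i := m)))" by auto
      ultimately show False using Forall(2) finite_subset by blast
    qed
    then have "Dfn M (\<lambda>e. sat M \<phi> (\<lambda>n. e ((\<rho>(i := m)) n)))" by (rule Forall(1))
    moreover have "(\<lambda>n. e ((\<rho>(i := m)) n)) = (\<lambda>n. e (\<rho> n))(i := e m)" for e :: "nat \<Rightarrow> 'a" by auto
    ultimately have "Dfn M (\<lambda>e. sat M \<phi> ((\<lambda>n. e (\<rho> n))(i := e m)))" by (simp only:)
    then have "Dfn M (\<lambda>e. \<forall>x\<in>M. sat M \<phi> ((\<lambda>n. e (\<rho> n))(i := x)))"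
      by (intro Dfn_all[where k = m]) (simp_all add: upd del: fun_upd_apply)
    then show ?case by simp
  qed (auto intro: Dfn_mem Dfn_eq Dfn_not Dfn_conj)
  obtain \<phi> where phi: "\<And>e. range e \<subseteq> M \<Longrightarrow> sat M \<phi> e \<longleftrightarrow> P e" using assms(1) by (auto simp: Dfn_def)
  show ?thesis
    by (rule Dfn_iff[OF *[OF assms(2), of \<phi>]]) (rule phi[symmetric], auto)
qed

lemma Dfn_rename_finite: "Dfn M P \<Longrightarrow> finite (range \<rho>) \<Longrightarrow> Dfn M (\<lambda>e. P (\<lambda>n. e (\<rho> n)))"
  by (rule Dfn_rename) (auto simp: Compl_eq_Diff_UNIV intro: Diff_infinite_finite)

text \<open>By these three rules a notion is written once, with 0, 1, 2 as free and other small
  numbers as bound variables, and is then available for any variables, equal ones included.\<close>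

lemma Dfn1: "Dfn M (\<lambda>e. R (e 0)) \<Longrightarrow> Dfn M (\<lambda>e. R (e i))"
  using Dfn_rename_finite[of M "\<lambda>e. R (e 0)" "\<lambda>n. i"] by simp

lemma Dfn2: "Dfn M (\<lambda>e. R (e 0) (e 1)) \<Longrightarrow> Dfn M (\<lambda>e. R (e i) (e j))"
  using Dfn_rename_finite[of M "\<lambda>e. R (e 0) (e 1)" "\<lambda>n. if n = 0 then i else j"]
  by (simp add: image_def)

lemma Dfn3: "Dfn M (\<lambda>e. R (e 0) (e 1) (e 2)) \<Longrightarrow> Dfn M (\<lambda>e. R (e i) (e j) (e k))"
proof -
  have "range (\<lambda>n::nat. if n = 0 then i else if n = 1 then j else k) \<subseteq> {i, j, k}" by auto
  then have "finite (range (\<lambda>n::nat. if n = 0 then i else if n = 1 then j else k))"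
    by (rule finite_subset) simp
  then show "Dfn M (\<lambda>e. R (e 0) (e 1) (e 2)) \<Longrightarrow> Dfn M (\<lambda>e. R (e i) (e j) (e k))"
    using Dfn_rename_finite[of M "\<lambda>e. R (e 0) (e 1) (e 2)"] by fastforce
qed

text \<open>The instances are the \<open>V_\<delta>\<close> with \<delta> zero or a limit.
  Transitivity makes extensionality and bounded quantifiers absolute, closure under subsets makes
  power sets of members correct, and successors serve \<open>two\<close>.\<close>

locale universe =
  fixes M :: "'a::zfc set"
  assumes M_trans: "x \<in> M \<Longrightarrow> y \<in> elts x \<Longrightarrow> y \<in> M"
    and M_subset: "x \<in> M \<Longrightarrow> elts y \<subseteq> elts x \<Longrightarrow> y \<in> M"
    and M_osucc: "x \<in> M \<Longrightarrow> osucc x \<in> M"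
begin

lemma M_eqI: "elts x \<subseteq> M \<Longrightarrow> elts y \<subseteq> M \<Longrightarrow> (\<And>z. z \<in> M \<Longrightarrow> z \<in> elts x \<longleftrightarrow> z \<in> elts y) \<Longrightarrow> x = y"
  by (rule extensionality) blast

lemma elts_M: "x \<in> M \<Longrightarrow> elts x \<subseteq> M"
  using M_trans by blast

lemma env_M: "range e \<subseteq> M \<Longrightarrow> e i \<in> M"
  by auto

lemma M_opair:
  assumes "opair a b \<in> M"
  shows "a \<in> M" "b \<in> M" "mkset {a} \<in> M" "mkset {a, b} \<in> M"
proof -
  show "mkset {a} \<in> M" "mkset {a, b} \<in> M" using M_trans[OF assms] by (auto simp: opair_def)
  then show "a \<in> M" "b \<in> M" using M_trans[of "mkset {a, b}"] by auto
qed

lemma app_M: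
  assumes "opair a b \<in> elts (e i)" "range e \<subseteq> M"
  shows "a \<in> M" "b \<in> M"
  by (rule M_opair[OF M_trans[OF env_M[OF assms(2)] assms(1)]])+

lemma Dfn_ball:
  assumes "j \<noteq> k" "\<And>e v x. P (e(k := v)) x = P e x" "Dfn M (\<lambda>e. P e (e k))"
  shows "Dfn M (\<lambda>e. \<forall>x\<in>elts (e j). P e x)"
proof (rule Dfn_iff)
  show "Dfn M (\<lambda>e. \<forall>x\<in>M. x \<in> elts (e j) \<longrightarrow> P e x)"
    by (rule Dfn_all[where k = k]) (use assms in \<open>auto intro!: Dfn_imp Dfn_mem\<close>)
  fix e :: "nat \<Rightarrow> 'a" assume "range e \<subseteq> M"
  then have "elts (e j) \<subseteq> M" by (rule elts_M[OF env_M])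
  then show "(\<forall>x\<in>elts (e j). P e x) \<longleftrightarrow> (\<forall>x\<in>M. x \<in> elts (e j) \<longrightarrow> P e x)" by blast
qed

lemma Dfn_bex:
  assumes "j \<noteq> k" "\<And>e v x. P (e(k := v)) x = P e x" "Dfn M (\<lambda>e. P e (e k))"
  shows "Dfn M (\<lambda>e. \<exists>x\<in>elts (e j). P e x)"
proof (rule Dfn_iff)
  show "Dfn M (\<lambda>e. \<not> (\<forall>x\<in>elts (e j). \<not> P e x))"
    by (rule Dfn_not, rule Dfn_ball[where k = k], rule assms(1), simp add: assms(2), rule Dfn_not, rule assms(3))
qed auto

text \<open>For each fixed \<phi>, induction relativises the quantifiers to the set
  \<open>e k\<close>; satisfaction is not defined inside the language. The new bound variable must
  also differ from \<open>k\<close>.\<close>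

lemma Dfn_sat:
  assumes "infinite (- range \<rho>)"
  shows "Dfn M (\<lambda>e. sat (elts (e k)) \<phi> (\<lambda>n. e (\<rho> n)))"
  using assms
proof (induction \<phi> arbitrary: \<rho>)
  case (Forall i \<phi>)
  then have "infinite (- range \<rho> - {k})" by simp
  then obtain m where m: "m \<notin> range \<rho>" "m \<noteq> k"
    by (metis (no_types, lifting) ComplD Diff_iff finite.emptyI insertI1 infinite_super subsetI)
  have upd: "(\<lambda>n. (e(m := v)) (\<rho> n)) = (\<lambda>n. e (\<rho> n))" for e :: "nat \<Rightarrow> 'a" and v
    using m by (auto simp: fun_eq_iff)
  have "infinite (- range (\<rho>(i := m)))"
  proof
    assume "finite (- range (\<rho>(i := m)))"
    then have "finite (insert m (- range (\<rho>(i := m))))" by simp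
    moreover have "- range \<rho> \<subseteq> insert m (- range (\<rho>(i := m)))" by auto
    ultimately show False using Forall(2) finite_subset by blast
  qed
  then have "Dfn M (\<lambda>e. sat (elts (e k)) \<phi> (\<lambda>n. e ((\<rho>(i := m)) n)))" by (rule Forall(1))
  moreover have "(\<lambda>n. e ((\<rho>(i := m)) n)) = (\<lambda>n. e (\<rho> n))(i := e m)" for e :: "nat \<Rightarrow> 'a" by auto
  ultimately have "Dfn M (\<lambda>e. sat (elts (e k)) \<phi> ((\<lambda>n. e (\<rho> n))(i := e m)))" by (simp only:)
  then have "Dfn M (\<lambda>e. \<forall>x\<in>elts (e k). sat (elts (e k)) \<phi> ((\<lambda>n. e (\<rho> n))(i := x)))"
    using m(2) by (intro Dfn_ball[where k = m]) (auto simp: upd simp del: fun_upd_apply simp: fun_upd_other)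
  then show ?case by simp
qed (auto intro: Dfn_mem Dfn_eq Dfn_not Dfn_conj)

lemma Dfn_subset: "Dfn M (\<lambda>e. elts (e i) \<subseteq> elts (e j))"
proof (rule Dfn2[of M "\<lambda>x y. elts x \<subseteq> elts y"])
  show "Dfn M (\<lambda>e. elts (e 0) \<subseteq> elts (e 1))"
    unfolding subset_eq by (rule Dfn_ball[where k = 2]) (simp_all add: Dfn_mem)
qed

lemma Dfn_zero: "Dfn M (\<lambda>e. e i = zero)"
proof (rule Dfn1[of M "\<lambda>x. x = zero"])
  have "Dfn M (\<lambda>e. \<forall>x\<in>elts (e 0). x \<noteq> x)"
    by (rule Dfn_ball[where k = 1], simp, simp, intro Dfn_not Dfn_eq)
  then show "Dfn M (\<lambda>e. e 0 = zero)"
    by (rule Dfn_iff) (use elts_eq_empty in blast)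
qed

lemma Dfn_osucc: "Dfn M (\<lambda>e. e i = osucc (e j))"
proof (rule Dfn2[of M "\<lambda>x y. x = osucc y"])
  have "Dfn M (\<lambda>e. \<forall>x\<in>M. x \<in> elts (e 0) \<longleftrightarrow> x = e 1 \<or> x \<in> elts (e 1))"
    by (rule Dfn_all[where k = 2]) (auto intro!: Dfn_mem Dfn_eq Dfn_equiv Dfn_disj)
  then show "Dfn M (\<lambda>e. e 0 = osucc (e 1))"
  proof (rule Dfn_iff)
    fix e :: "nat \<Rightarrow> 'a" assume e: "range e \<subseteq> M"
    have "elts (osucc (e 1)) \<subseteq> M" using elts_M env_M[OF e] by simp
    then show "e 0 = osucc (e 1) \<longleftrightarrow> (\<forall>x\<in>M. x \<in> elts (e 0) \<longleftrightarrow> x = e 1 \<or> x \<in> elts (e 1))"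
      using M_eqI[OF elts_M[OF env_M[OF e, of 0]], of "osucc (e 1)"] by auto
  qed
qed

lemma Dfn_pair: "Dfn M (\<lambda>e. e i = mkset {e j, e k})"
proof (rule Dfn3[of M "\<lambda>x y z. x = mkset {y, z}"])
  have "Dfn M (\<lambda>e. \<forall>x\<in>M. x \<in> elts (e 0) \<longleftrightarrow> x = e 1 \<or> x = e 2)"
    by (rule Dfn_all[where k = 3]) (auto intro!: Dfn_mem Dfn_eq Dfn_equiv Dfn_disj)
  then show "Dfn M (\<lambda>e. e 0 = mkset {e 1, e 2})"
  proof (rule Dfn_iff)
    fix e :: "nat \<Rightarrow> 'a" assume e: "range e \<subseteq> M"
    have "elts (mkset {e 1, e 2}) \<subseteq> M" using env_M[OF e] by simp
    then show "e 0 = mkset {e 1, e 2} \<longleftrightarrow> (\<forall>x\<in>M. x \<in> elts (e 0) \<longleftrightarrow> x = e 1 \<or> x = e 2)"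
      using M_eqI[OF elts_M[OF env_M[OF e, of 0]], of "mkset {e 1, e 2}"] by auto
  qed
qed

lemma Dfn_opair: "Dfn M (\<lambda>e. e i = opair (e j) (e k))"
proof (rule Dfn3[of M "\<lambda>x y z. x = opair y z"])
  have "Dfn M (\<lambda>e. \<exists>a\<in>M. \<exists>b\<in>M. a = mkset {e 1, e 1} \<and> b = mkset {e 1, e 2} \<and> e 0 = mkset {a, b})"
    by (rule Dfn_ex[where k = 3], simp, rule Dfn_ex[where k = 4], simp, intro Dfn_conj Dfn_pair)
  then show "Dfn M (\<lambda>e. e 0 = opair (e 1) (e 2))"
  proof (rule Dfn_iff)
    fix e :: "nat \<Rightarrow> 'a" assume e: "range e \<subseteq> M"
    show "e 0 = opair (e 1) (e 2) \<longleftrightarrow>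
      (\<exists>a\<in>M. \<exists>b\<in>M. a = mkset {e 1, e 1} \<and> b = mkset {e 1, e 2} \<and> e 0 = mkset {a, b})"
      using M_opair[of "e 1" "e 2"] env_M[OF e, of 0] by (auto simp: opair_def)
  qed
qed

lemma Dfn_app: "Dfn M (\<lambda>e. opair (e i) (e j) \<in> elts (e k))"
proof (rule Dfn3[of M "\<lambda>x y z. opair x y \<in> elts z"])
  have "Dfn M (\<lambda>e. \<exists>x\<in>elts (e 2). x = opair (e 0) (e 1))"
    by (rule Dfn_bex[where k = 3]) (simp_all add: Dfn_opair)
  then show "Dfn M (\<lambda>e. opair (e 0) (e 1) \<in> elts (e 2))" by (rule Dfn_iff) auto
qed

lemma Dfn_succ: "Dfn M (\<lambda>e. \<exists>\<beta>. e i = osucc \<beta>)"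
proof (rule Dfn1[of M "\<lambda>x. \<exists>\<beta>. x = osucc \<beta>"])
  have "Dfn M (\<lambda>e. \<exists>x\<in>elts (e 0). e 0 = osucc x)"
    by (rule Dfn_bex[where k = 1]) (simp_all add: Dfn_osucc)
  then show "Dfn M (\<lambda>e. \<exists>\<beta>. e 0 = osucc \<beta>)" by (rule Dfn_iff) auto
qed

lemma Dfn_app_zero: "Dfn M (\<lambda>e. opair (e i) zero \<in> elts (e j))"
proof (rule Dfn2[of M "\<lambda>x y. opair x zero \<in> elts y"])
  have "Dfn M (\<lambda>e. \<exists>x\<in>M. x = zero \<and> opair (e 0) x \<in> elts (e 1))"
    by (rule Dfn_ex[where k = 2]) (simp_all add: Dfn_app Dfn_zero Dfn_conj)
  then show "Dfn M (\<lambda>e. opair (e 0) zero \<in> elts (e 1))"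
    by (rule Dfn_iff) (auto dest: app_M)
qed

lemma Dfn_app_osucc: "Dfn M (\<lambda>e. opair (e i) (osucc (e j)) \<in> elts (e k))"
proof (rule Dfn3[of M "\<lambda>x y z. opair x (osucc y) \<in> elts z"])
  have "Dfn M (\<lambda>e. \<exists>x\<in>M. x = osucc (e 1) \<and> opair (e 0) x \<in> elts (e 2))"
    by (rule Dfn_ex[where k = 3]) (simp_all add: Dfn_app Dfn_osucc Dfn_conj)
  then show "Dfn M (\<lambda>e. opair (e 0) (osucc (e 1)) \<in> elts (e 2))"
    by (rule Dfn_iff) (auto dest: app_M)
qed

lemma Dfn_two: "Dfn M (\<lambda>e. e i = two (e j))"
proof (rule Dfn2[of M "\<lambda>x y. x = two y"])
  have "Dfn M (\<lambda>e. \<exists>x\<in>M. x = osucc (e 1) \<and> e 0 = osucc x)"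
    by (rule Dfn_ex[where k = 2]) (simp_all add: Dfn_osucc Dfn_conj)
  then show "Dfn M (\<lambda>e. e 0 = two (e 1))"
    by (rule Dfn_iff) (use M_osucc env_M in \<open>auto simp: two_def\<close>)
qed

end

lemma universe_Vlevel: "zero_or_limit \<delta> \<Longrightarrow> universe (Vlevel \<delta>)"
  using Vlevel_trans Vlevel_subset osucc_in_Vlevel limit_Ord by unfold_locales blast+

section \<open>Formulas for levels, parity, block numbers and decoding\<close>

context universe
begin

text \<open>Levels in the manner of Scott and Potter: \<open>h\<close> is a history, each member of
  which consists of the subsets of those members of \<open>h\<close> that belong to it. This uses no
  indexed recursion; the index \<alpha> is recovered as the first ordinal outside
  \<open>v\<close>.\<close>

definition is_level :: "'a \<Rightarrow> 'a \<Rightarrow> bool" where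
  "is_level v \<alpha> \<longleftrightarrow>
     (\<exists>h\<in>M. (\<forall>a\<in>elts h. \<forall>x\<in>M. x \<in> elts a \<longleftrightarrow> (\<exists>b\<in>elts h. b \<in> elts a \<and> elts x \<subseteq> elts b)) \<and>
       (\<forall>x\<in>M. x \<in> elts v \<longleftrightarrow> (\<exists>b\<in>elts h. elts x \<subseteq> elts b))) \<and>
     elts \<alpha> \<subseteq> elts v \<and> \<alpha> \<notin> elts v"

lemma Dfn_is_level: "Dfn M (\<lambda>e. is_level (e i) (e j))"
proof (rule Dfn2)
  show "Dfn M (\<lambda>e. is_level (e 0) (e 1))"
    unfolding is_level_def
    apply (intro Dfn_conj Dfn_subset Dfn_not[OF Dfn_mem])
    apply (rule Dfn_ex[where k = 2], simp)
    apply (rule Dfn_conj)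
     apply (rule Dfn_ball[where k = 3], simp, simp)
     apply (rule Dfn_all[where k = 4], simp)
     apply (rule Dfn_equiv[OF Dfn_mem])
     apply (rule Dfn_bex[where k = 5], simp, simp)
     apply (intro Dfn_conj Dfn_mem Dfn_subset)
    apply (rule Dfn_all[where k = 3], simp)
    apply (rule Dfn_equiv[OF Dfn_mem])
    apply (rule Dfn_bex[where k = 4], simp, simp)
    apply (rule Dfn_subset)
    done
qed

text \<open>The set of the levels below \<alpha>, assumed to be in \<open>M\<close>, is the history
  for the converse direction.\<close>

lemma is_level_iff:
  assumes v: "v \<in> M" and \<alpha>: "Ord \<alpha>" and h: "mkset ((\<lambda>\<beta>. mkset (Vlevel \<beta>)) ` elts \<alpha>) \<in> M"
  shows "is_level v \<alpha> \<longleftrightarrow> elts v = Vlevel \<alpha>"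
proof
  assume "is_level v \<alpha>"
  then obtain h where h: "h \<in> M"
    "\<forall>a\<in>elts h. \<forall>x\<in>M. x \<in> elts a \<longleftrightarrow> (\<exists>b\<in>elts h. b \<in> elts a \<and> elts x \<subseteq> elts b)"
    "\<forall>x\<in>M. x \<in> elts v \<longleftrightarrow> (\<exists>b\<in>elts h. elts x \<subseteq> elts b)"
    and \<alpha>v: "elts \<alpha> \<subseteq> elts v" "\<alpha> \<notin> elts v"
    unfolding is_level_def by (elim conjE bexE) (rule that)
  have sub_M: "x \<in> M" if "b \<in> elts h" "elts x \<subseteq> elts b" for b x
    using that M_subset M_trans h(1) by blast
  \<comment> \<open>The index found for \<open>a\<close> is the set of the indices of the members of
    \<open>h\<close> inside \<open>a\<close>, not visibly an ordinal; \<open>Vlevel_eq_Ord\<close>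
    repairs this afterwards.\<close>
  have "\<exists>c. elts a = Vlevel c" if "a \<in> elts h" for a
    using that
  proof (induction a rule: elts_induct)
    case (1 a)
    then obtain f where f: "\<And>b. b \<in> elts a \<Longrightarrow> b \<in> elts h \<Longrightarrow> elts b = Vlevel (f b)" by metis
    have c: "elts (mkset (f ` (elts a \<inter> elts h))) = f ` (elts a \<inter> elts h)"
      by (intro elts_mkset small_image small_subset[OF small_elts[of a]]) auto
    have a: "x \<in> elts a \<longleftrightarrow> (\<exists>b\<in>elts a \<inter> elts h. elts x \<subseteq> elts b)" for x
      using bspec[OF h(2) 1(2)] sub_M elts_M[OF M_trans[OF h(1) 1(2)]] by blast
    have "elts a = Vlevel (mkset (f ` (elts a \<inter> elts h)))"
      by (rule set_eqI, subst a, subst mem_Vlevel, subst c) (simp add: f)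
    then show ?case by blast
  qed
  then obtain f where f: "\<And>a. a \<in> elts h \<Longrightarrow> elts a = Vlevel (f a)" by metis
  have elts_v: "x \<in> elts v \<longleftrightarrow> (\<exists>b\<in>elts h. elts x \<subseteq> elts b)" for x
    using h(3) sub_M elts_M[OF v] by blast
  have "elts v = Vlevel (mkset (f ` elts h))"
    by (rule set_eqI, subst elts_v, subst mem_Vlevel) (simp add: f)
  then obtain \<gamma> where g: "Ord \<gamma>" "elts v = Vlevel \<gamma>" using Vlevel_eq_Ord by metis
  have "\<gamma> = \<alpha>"
    using Ord_linear[OF g(1) \<alpha>] \<alpha>v g Ord_mem_Vlevel[OF g(1) \<alpha>] Ord_mem_Vlevel[OF g(1,1)] by auto
  then show "elts v = Vlevel \<alpha>" using g(2) by simp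
next
  assume eq: "elts v = Vlevel \<alpha>"
  let ?h = "mkset ((\<lambda>\<beta>. mkset (Vlevel \<beta>)) ` elts \<alpha>)"
  have eh: "elts ?h = (\<lambda>\<beta>. mkset (Vlevel \<beta>)) ` elts \<alpha>" by simp
  have "x \<in> Vlevel \<beta> \<longleftrightarrow> (\<exists>\<gamma>\<in>elts \<alpha>. mkset (Vlevel \<gamma>) \<in> Vlevel \<beta> \<and> elts x \<subseteq> Vlevel \<gamma>)"
    if \<beta>: "\<beta> \<in> elts \<alpha>" for \<beta> x
  proof
    assume "x \<in> Vlevel \<beta>"
    then obtain \<gamma> where g: "\<gamma> \<in> elts \<beta>" "elts x \<subseteq> Vlevel \<gamma>" by (auto simp: mem_Vlevel)
    then have "mkset (Vlevel \<gamma>) \<in> Vlevel \<beta>" by (auto simp: mem_Vlevel)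
    then show "\<exists>\<gamma>\<in>elts \<alpha>. mkset (Vlevel \<gamma>) \<in> Vlevel \<beta> \<and> elts x \<subseteq> Vlevel \<gamma>"
      using g \<beta> Ord_trans[OF \<alpha>] by blast
  next
    assume "\<exists>\<gamma>\<in>elts \<alpha>. mkset (Vlevel \<gamma>) \<in> Vlevel \<beta> \<and> elts x \<subseteq> Vlevel \<gamma>"
    then show "x \<in> Vlevel \<beta>" using Vlevel_subset by fastforce
  qed
  then have 1: "\<forall>a\<in>elts ?h. \<forall>x\<in>M. x \<in> elts a \<longleftrightarrow> (\<exists>b\<in>elts ?h. b \<in> elts a \<and> elts x \<subseteq> elts b)"
    unfolding eh by simp
  have 2: "\<forall>x\<in>M. x \<in> elts v \<longleftrightarrow> (\<exists>b\<in>elts ?h. elts x \<subseteq> elts b)"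
    unfolding eh eq mem_Vlevel[of _ \<alpha>] by simp
  have 3: "elts \<alpha> \<subseteq> elts v" "\<alpha> \<notin> elts v"
    using Ord_mem_Vlevel[OF \<alpha>] Ord_in_Ord[OF \<alpha>] \<alpha> by (auto simp: eq)
  show "is_level v \<alpha>" unfolding is_level_def using 1 2 3 h by blast
qed

text \<open>Parity without finite parts: an ordinal is even unless it is the successor of an even
  one. On \<open>omega1\<close> this recursion has only one solution.\<close>

definition is_even :: "'a \<Rightarrow> 'a \<Rightarrow> bool" where
  "is_even E w \<longleftrightarrow> (\<forall>\<eta>\<in>elts w. \<eta> \<in> elts E \<longleftrightarrow> (\<forall>\<beta>\<in>elts \<eta>. \<eta> = osucc \<beta> \<longrightarrow> \<beta> \<notin> elts E))"

lemma Dfn_is_even: "Dfn M (\<lambda>e. is_even (e i) (e j))"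
proof (rule Dfn2)
  show "Dfn M (\<lambda>e. is_even (e 0) (e 1))"
    unfolding is_even_def
    apply (rule Dfn_ball[where k = 2], simp, simp)
    apply (rule Dfn_equiv[OF Dfn_mem])
    apply (rule Dfn_ball[where k = 3], simp, simp)
    apply (intro Dfn_imp Dfn_osucc Dfn_not Dfn_mem)
    done
qed

lemma is_even_iff: "is_even E omega1 \<longleftrightarrow> (\<forall>\<eta>\<in>elts omega1. \<eta> \<in> elts E \<longleftrightarrow> first_turn \<eta>)"
proof -
  have step: "(\<forall>\<beta>\<in>elts \<eta>. \<eta> = osucc \<beta> \<longrightarrow> \<beta> \<notin> elts E) \<longleftrightarrow> first_turn \<eta>"
    if eta: "\<eta> \<in> elts omega1" "\<And>\<beta>. \<beta> \<in> elts \<eta> \<Longrightarrow> \<beta> \<in> elts E \<longleftrightarrow> first_turn \<beta>" for \<eta>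
  proof (cases "zero_or_limit \<eta>")
    case True
    then show ?thesis by (auto simp: first_turn_limit)
  next
    case False
    then obtain \<beta> where b: "\<eta> = osucc \<beta>" using omega1_Ord[OF eta(1)] by (auto simp: zero_or_limit_def)
    then have "first_turn \<eta> \<longleftrightarrow> \<not> first_turn \<beta>"
      using omega1_Ord[OF eta(1)] by (simp add: Ord_osucc_iff first_turn_osucc)
    then show ?thesis using eta(2) b by simp
  qed
  show ?thesis
  proof
    assume ev: "is_even E omega1"
    have "\<eta> \<in> elts E \<longleftrightarrow> first_turn \<eta>" if "\<eta> \<in> elts omega1" for \<eta>
      using that
    proof (induction \<eta> rule: elts_induct)
      case (1 \<eta>)
      then show ?case using step[OF 1(2)] ev omega1_trans[OF 1(2)] unfolding is_even_def by blast
    qed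
    then show "\<forall>\<eta>\<in>elts omega1. \<eta> \<in> elts E \<longleftrightarrow> first_turn \<eta>" by blast
  next
    assume "\<forall>\<eta>\<in>elts omega1. \<eta> \<in> elts E \<longleftrightarrow> first_turn \<eta>"
    then show "is_even E omega1" unfolding is_even_def using step omega1_trans by metis
  qed
qed

text \<open>The equation \<open>elts_block\<close> for a graph \<open>N\<close>; the conditions on
  \<open>\<eta>'\<close> spell out membership in \<open>earlier \<mu> \<eta>\<close>.\<close>

definition is_block :: "'a \<Rightarrow> 'a \<Rightarrow> 'a \<Rightarrow> bool" where
  "is_block N w \<mu> \<longleftrightarrow> (\<forall>\<eta>\<in>elts w. \<forall>\<xi>\<in>M. opair \<eta> \<xi> \<in> elts N \<longleftrightarrow>
     (\<forall>y\<in>M. y \<in> elts \<xi> \<longleftrightarrow> (\<exists>\<eta>'\<in>elts \<eta>. (\<eta>' \<notin> elts \<mu> \<and>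
        (\<exists>\<delta>\<in>elts w. \<not> (\<exists>\<beta>. \<delta> = osucc \<beta>) \<and> \<eta>' \<in> elts \<delta> \<and> (\<delta> \<in> elts \<eta> \<or> \<delta> = \<eta>))) \<and>
        opair \<eta>' y \<in> elts N)))"

lemma Dfn_is_block: "Dfn M (\<lambda>e. is_block (e i) (e j) (e k))"
proof (rule Dfn3)
  show "Dfn M (\<lambda>e. is_block (e 0) (e 1) (e 2))"
    unfolding is_block_def
    apply (rule Dfn_ball[where k = 3], simp, simp)
    apply (rule Dfn_all[where k = 4], simp)
    apply (rule Dfn_equiv[OF Dfn_app])
    apply (rule Dfn_all[where k = 5], simp)
    apply (rule Dfn_equiv[OF Dfn_mem])
    apply (rule Dfn_bex[where k = 6], simp, simp)
    apply (intro Dfn_conj Dfn_not Dfn_mem Dfn_app)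
    apply (rule Dfn_bex[where k = 7], simp, simp)
    apply (intro Dfn_conj Dfn_disj Dfn_not Dfn_mem Dfn_eq Dfn_succ)
    done
qed

lemma is_block_iff:
  assumes "omega1 \<in> M"
  shows "is_block N omega1 \<mu> \<longleftrightarrow> (\<forall>\<eta>\<in>elts omega1. \<forall>\<xi>\<in>M. opair \<eta> \<xi> \<in> elts N \<longleftrightarrow> \<xi> = block \<mu> \<eta>)"
proof -
  have earlier: "\<eta>' \<in> elts \<eta> \<and> (\<eta>' \<notin> elts \<mu> \<and>
        (\<exists>\<delta>\<in>elts omega1. \<not> (\<exists>\<beta>. \<delta> = osucc \<beta>) \<and> \<eta>' \<in> elts \<delta> \<and> (\<delta> \<in> elts \<eta> \<or> \<delta> = \<eta>))) \<longleftrightarrow> \<eta>' \<in> earlier \<mu> \<eta>"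
    if "\<eta> \<in> elts omega1" for \<eta> \<eta>'
    using that omega1_trans[OF that] omega1_Ord unfolding earlier_def zero_or_limit_def by blast
  have step: "(\<forall>y\<in>M. y \<in> elts \<xi> \<longleftrightarrow> (\<exists>\<eta>'\<in>elts \<eta>. (\<eta>' \<notin> elts \<mu> \<and>
        (\<exists>\<delta>\<in>elts omega1. \<not> (\<exists>\<beta>. \<delta> = osucc \<beta>) \<and> \<eta>' \<in> elts \<delta> \<and> (\<delta> \<in> elts \<eta> \<or> \<delta> = \<eta>))) \<and>
        opair \<eta>' y \<in> elts N)) \<longleftrightarrow> \<xi> = block \<mu> \<eta>" (is "?L \<longleftrightarrow> _")
    if eta: "\<eta> \<in> elts omega1" and xi: "\<xi> \<in> M"
      and IH: "\<And>\<eta>' y. \<eta>' \<in> elts \<eta> \<Longrightarrow> y \<in> M \<Longrightarrow> opair \<eta>' y \<in> elts N \<longleftrightarrow> y = block \<mu> \<eta>'" for \<eta> \<xi>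
  proof -
    have "?L \<longleftrightarrow> (\<forall>y\<in>M. y \<in> elts \<xi> \<longleftrightarrow> (\<exists>\<eta>'. \<eta>' \<in> earlier \<mu> \<eta> \<and> opair \<eta>' y \<in> elts N))"
      unfolding earlier[OF eta, symmetric] by blast
    also have "\<dots> \<longleftrightarrow> (\<forall>y\<in>M. y \<in> elts \<xi> \<longleftrightarrow> y \<in> elts (block \<mu> \<eta>))"
    proof -
      have "(\<exists>\<eta>'. \<eta>' \<in> earlier \<mu> \<eta> \<and> opair \<eta>' y \<in> elts N) \<longleftrightarrow> y \<in> elts (block \<mu> \<eta>)" if "y \<in> M" for y
        unfolding elts_block image_iff Bex_def using IH[OF subsetD[OF earlier_subset] that] by metis
      then show ?thesis by simp
    qed
    also have "\<dots> \<longleftrightarrow> \<xi> = block \<mu> \<eta>"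
    proof -
      have "block \<mu> \<eta> \<in> M" using M_trans[OF assms block_in_omega1[OF eta]] .
      then show ?thesis using M_eqI[OF elts_M[OF xi] elts_M] by blast
    qed
    finally show ?thesis .
  qed
  show ?thesis
  proof
    assume bl: "is_block N omega1 \<mu>"
    have "\<forall>\<xi>\<in>M. opair \<eta> \<xi> \<in> elts N \<longleftrightarrow> \<xi> = block \<mu> \<eta>" if "\<eta> \<in> elts omega1" for \<eta>
      using that
    proof (induction \<eta> rule: elts_induct)
      case (1 \<eta>)
      show ?case
      proof
        fix \<xi> assume xi: "\<xi> \<in> M"
        show "opair \<eta> \<xi> \<in> elts N \<longleftrightarrow> \<xi> = block \<mu> \<eta>"
          by (rule trans[OF bspec[OF bspec[OF bl[unfolded is_block_def] 1(2)] xi] step[OF 1(2) xi]])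
            (rule bspec[OF 1(1)], assumption, rule omega1_trans[OF 1(2)])
      qed
    qed
    then show "\<forall>\<eta>\<in>elts omega1. \<forall>\<xi>\<in>M. opair \<eta> \<xi> \<in> elts N \<longleftrightarrow> \<xi> = block \<mu> \<eta>" by blast
  next
    assume a: "\<forall>\<eta>\<in>elts omega1. \<forall>\<xi>\<in>M. opair \<eta> \<xi> \<in> elts N \<longleftrightarrow> \<xi> = block \<mu> \<eta>"
    show "is_block N omega1 \<mu>" unfolding is_block_def
    proof (intro ballI)
      fix \<eta> \<xi> :: 'a assume e: "\<eta> \<in> elts omega1" "\<xi> \<in> M"
      show "opair \<eta> \<xi> \<in> elts N \<longleftrightarrow> (\<forall>y\<in>M. y \<in> elts \<xi> \<longleftrightarrow> (\<exists>\<eta>'\<in>elts \<eta>. (\<eta>' \<notin> elts \<mu> \<and>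
        (\<exists>\<delta>\<in>elts omega1. \<not> (\<exists>\<beta>. \<delta> = osucc \<beta>) \<and> \<eta>' \<in> elts \<delta> \<and> (\<delta> \<in> elts \<eta> \<or> \<delta> = \<eta>))) \<and>
        opair \<eta>' y \<in> elts N))"
        by (subst step[OF e]) (use a e omega1_trans[OF e(1)] in auto)
    qed
  qed
qed

text \<open>In the formulas a play is the set \<open>P\<close> of its pairs, and a move is queried
  by membership of a pair.\<close>

definition is_triple :: "'a \<Rightarrow> 'a \<Rightarrow> 'a \<Rightarrow> bool" where
  "is_triple z P \<eta> \<longleftrightarrow> (\<exists>a\<in>M. \<exists>b\<in>M. \<exists>u\<in>M. \<exists>v\<in>M. u = two \<eta> \<and> v = two u \<and> z = opair a b \<and>
     opair \<eta> zero \<in> elts P \<and> opair u (osucc a) \<in> elts P \<and> opair v (osucc b) \<in> elts P)"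

lemma Dfn_is_triple: "Dfn M (\<lambda>e. is_triple (e i) (e j) (e k))"
proof (rule Dfn3)
  show "Dfn M (\<lambda>e. is_triple (e 0) (e 1) (e 2))"
    unfolding is_triple_def
    apply (rule Dfn_ex[where k = 3], simp)
    apply (rule Dfn_ex[where k = 4], simp)
    apply (rule Dfn_ex[where k = 5], simp)
    apply (rule Dfn_ex[where k = 6], simp)
    apply (intro Dfn_conj Dfn_two Dfn_opair Dfn_app_zero Dfn_app_osucc)
    done
qed

definition is_dec_init :: "'a \<Rightarrow> 'a \<Rightarrow> 'a \<Rightarrow> bool \<Rightarrow> 'a \<Rightarrow> bool" where
  "is_dec_init \<nu> E P b x \<longleftrightarrow>
     (\<forall>z\<in>M. z \<in> elts x \<longleftrightarrow> (\<exists>\<eta>\<in>elts \<nu>. (\<eta> \<in> elts E \<longleftrightarrow> b) \<and> is_triple z P \<eta>))"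

definition is_dec_block :: "'a \<Rightarrow> 'a \<Rightarrow> 'a \<Rightarrow> 'a \<Rightarrow> 'a \<Rightarrow> 'a \<Rightarrow> 'a \<Rightarrow> 'a \<Rightarrow> bool" where
  "is_dec_block w \<mu> \<rho> N E P \<xi> x \<longleftrightarrow>
     (\<forall>z\<in>M. z \<in> elts x \<longleftrightarrow> (\<exists>\<eta>\<in>elts w. \<eta> \<notin> elts \<mu> \<and> opair \<eta> \<xi> \<in> elts N \<and>
        (\<eta> \<in> elts E \<longleftrightarrow> (\<xi> \<in> elts E \<longleftrightarrow> opair \<rho> zero \<in> elts P)) \<and> is_triple z P \<eta>))"

definition is_move :: "'a \<Rightarrow> 'a \<Rightarrow> 'a \<Rightarrow> 'a \<Rightarrow> 'a \<Rightarrow> 'a \<Rightarrow> 'a \<Rightarrow> 'a \<Rightarrow> 'a \<Rightarrow> 'a \<Rightarrow> bool" where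
  "is_move w \<mu> \<rho> S N E P x\<^sub>0 \<xi> x \<longleftrightarrow> (x \<in> elts S \<and> is_dec_block w \<mu> \<rho> N E P \<xi> x) \<or>
     (x = x\<^sub>0 \<and> \<not> (\<exists>d\<in>elts S. is_dec_block w \<mu> \<rho> N E P \<xi> d))"

text \<open>The decoded play is sought as a member \<open>g\<close> of some \<open>A\<close>. Thus
  only its pairs have to be in \<open>M\<close>, for the comparison by extensionality.\<close>

definition is_win :: "'a \<Rightarrow> 'a \<Rightarrow> 'a \<Rightarrow> 'a \<Rightarrow> 'a \<Rightarrow> 'a \<Rightarrow> ('a \<Rightarrow> 'a \<Rightarrow> bool) \<Rightarrow> 'a \<Rightarrow> 'a \<Rightarrow> 'a \<Rightarrow> 'a \<Rightarrow> bool" where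
  "is_win w \<mu> \<nu> \<rho> \<theta> v Q S N E P \<longleftrightarrow> (\<forall>x\<^sub>0\<in>elts S. is_dec_init \<nu> E P False x\<^sub>0 \<longrightarrow>
     (opair \<rho> zero \<in> elts P \<longleftrightarrow> (\<exists>s\<in>M. is_dec_init \<nu> E P True s \<and> (\<exists>A\<in>elts v. Q A s \<and>
        (\<exists>g\<in>elts A. \<forall>z\<in>M. z \<in> elts g \<longleftrightarrow>
           (\<exists>\<xi>\<in>elts \<theta>. \<exists>x\<in>M. z = opair \<xi> x \<and> is_move w \<mu> \<rho> S N E P x\<^sub>0 \<xi> x))))))"

definition is_play :: "'a \<Rightarrow> 'a \<Rightarrow> 'a \<Rightarrow> bool" where
  "is_play w \<kappa> P \<longleftrightarrow> (\<forall>z\<in>elts P. \<exists>\<xi>\<in>elts w. \<exists>x\<in>elts \<kappa>. z = opair \<xi> x) \<and>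
     (\<forall>\<xi>\<in>elts w. \<exists>x\<in>elts \<kappa>. opair \<xi> x \<in> elts P \<and> (\<forall>y\<in>elts \<kappa>. opair \<xi> y \<in> elts P \<longrightarrow> y = x))"

lemma Dfn_is_dec_init: "Dfn M (\<lambda>e. is_dec_init (e i) (e j) (e k) b (e l))"
proof -
  have "finite (range (\<lambda>n::nat. if n = 0 then i else if n = 1 then j else if n = 2 then k else l))"
    by (rule finite_subset[of _ "{i, j, k, l}"]) auto
  moreover have "Dfn M (\<lambda>e. e 5 \<in> elts (e 1) \<longleftrightarrow> b)" by (cases b) (simp_all add: Dfn_mem Dfn_not)
  then have "Dfn M (\<lambda>e. is_dec_init (e 0) (e 1) (e 2) b (e 3))"
    unfolding is_dec_init_def
    apply -
    apply (rule Dfn_all[where k = 4], simp)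
    apply (rule Dfn_equiv[OF Dfn_mem])
    apply (rule Dfn_bex[where k = 5], simp, simp)
    apply (intro Dfn_conj Dfn_is_triple; assumption)
    done
  ultimately show ?thesis using Dfn_rename_finite by fastforce
qed

text \<open>Variables are fixed from here on: 10 is the level of \<open>A\<close>, 12 is
  \<open>S\<close>, 13 is \<open>E\<close>, 14 is \<open>N\<close>, 15 the play, 16 the default, 17
  the proposed parameter, 18 and 19 are \<open>A\<close> and \<open>g\<close>, 20 is \<xi>, and 21
  and 22 are candidate moves. Bound variables 30 and 31 avoid them all.\<close>

lemma Dfn_is_dec_block:
  assumes "k < 30"
  shows "Dfn M (\<lambda>e. is_dec_block (e 1) (e 3) (e 5) (e 14) (e 13) (e 15) (e 20) (e k))"
  unfolding is_dec_block_def
  using assms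
  apply -
  apply (rule Dfn_all[where k = 30], simp)
  apply (rule Dfn_equiv[OF Dfn_mem])
  apply (rule Dfn_bex[where k = 31], simp, simp)
  apply (intro Dfn_conj Dfn_equiv Dfn_not Dfn_mem Dfn_app Dfn_app_zero Dfn_is_triple)
  done

lemma Dfn_is_move: "Dfn M (\<lambda>e. is_move (e 1) (e 3) (e 5) (e 12) (e 14) (e 13) (e 15) (e 16) (e 20) (e 21))"
  unfolding is_move_def
  apply (intro Dfn_conj Dfn_disj Dfn_not Dfn_mem Dfn_eq Dfn_is_dec_block, simp)
  apply (rule Dfn_bex[where k = 22], simp, simp)
  apply (rule Dfn_is_dec_block, simp)
  done

lemma Dfn_is_win:
  assumes "Dfn M (\<lambda>e. Q e (e 18) (e 17))" "\<And>e k v. k < 100 \<Longrightarrow> k \<noteq> 10 \<Longrightarrow> Q (e(k := v)) = Q e"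
  shows "Dfn M (\<lambda>e. is_win (e 1) (e 3) (e 4) (e 5) (e 6) (e 10) (Q e) (e 12) (e 14) (e 13) (e 15))"
  unfolding is_win_def
  apply (rule Dfn_ball[where k = 16], simp, simp add: assms(2))
  apply (rule Dfn_imp[OF Dfn_is_dec_init])
  apply (rule Dfn_equiv[OF Dfn_app_zero])
  apply (rule Dfn_ex[where k = 17], simp add: assms(2))
  apply (rule Dfn_conj[OF Dfn_is_dec_init])
  apply (rule Dfn_bex[where k = 18], simp, simp add: assms(2))
  apply (rule Dfn_conj[OF assms(1)])
  apply (rule Dfn_bex[where k = 19], simp, simp)
  apply (rule Dfn_all[where k = 23], simp)
  apply (rule Dfn_equiv[OF Dfn_mem])
  apply (rule Dfn_bex[where k = 20], simp, simp)
  apply (rule Dfn_ex[where k = 21], simp)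
  apply (rule Dfn_conj[OF Dfn_opair Dfn_is_move])
  done

lemma Dfn_is_play: "Dfn M (\<lambda>e. is_play (e i) (e j) (e k))"
proof (rule Dfn3)
  show "Dfn M (\<lambda>e. is_play (e 0) (e 1) (e 2))"
    unfolding is_play_def
    apply (rule Dfn_conj)
     apply (rule Dfn_ball[where k = 3], simp, simp)
     apply (rule Dfn_bex[where k = 4], simp, simp)
     apply (rule Dfn_bex[where k = 5], simp, simp)
     apply (rule Dfn_opair)
    apply (rule Dfn_ball[where k = 3], simp, simp)
    apply (rule Dfn_bex[where k = 4], simp, simp)
    apply (rule Dfn_conj[OF Dfn_app])
    apply (rule Dfn_ball[where k = 5], simp, simp)
    apply (rule Dfn_imp[OF Dfn_app Dfn_eq])
    done
qed

text \<open>Separate parameters occupy one residue class modulo 3, which leaves infinitely many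
  variables for \<open>Dfn_sat\<close>. All places in \<open>T\<close> share the variable
  \<open>j\<close>.\<close>

lemma Dfn_sat_params:
  "Dfn M (\<lambda>e. sat (elts (e k)) \<phi> (\<lambda>n. if n = 0 then e i else if n \<in> T then e j else e (c + 3 * n)))"
proof -
  define \<rho> where "\<rho> n = (if n = 0 then i else if n \<in> T then j else c + 3 * n)" for n
  have "infinite (- range \<rho>)"
  proof
    assume "finite (- range \<rho>)"
    then have "finite ({i, j} \<union> - range \<rho>)" by simp
    moreover have "range (\<lambda>n. c + 3 * n + 1) \<subseteq> {i, j} \<union> - range \<rho>"
    proof
      fix m assume "m \<in> range (\<lambda>n. c + 3 * n + 1)"
      then obtain n where "m = c + 3 * n + 1" by blast
      then have "m \<noteq> c + 3 * n'" for n' by presburger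
      then show "m \<in> {i, j} \<union> - range \<rho>" by (auto simp: \<rho>_def split: if_splits)
    qed
    ultimately have "finite (range (\<lambda>n. c + 3 * n + 1))" using finite_subset by blast
    moreover have "inj (\<lambda>n. c + 3 * n + 1)" by (auto simp: inj_def)
    ultimately show False using range_inj_infinite by blast
  qed
  from Dfn_sat[OF this, of k \<phi>] show ?thesis
  proof (rule Dfn_iff)
    fix e :: "nat \<Rightarrow> 'a"
    have "(\<lambda>n. e (\<rho> n)) = (\<lambda>n. if n = 0 then e i else if n \<in> T then e j else e (c + 3 * n))"
      by (auto simp: \<rho>_def)
    then show "sat (elts (e k)) \<phi> (\<lambda>n. if n = 0 then e i else if n \<in> T then e j else e (c + 3 * n)) \<longleftrightarrow>
        sat (elts (e k)) \<phi> (\<lambda>n. e (\<rho> n))" by simp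
  qed
qed

end

text \<open>Everything decoded from a play is a subset of \<kappa> \<times> \<kappa>, whence
  \<open>pairs_M\<close>; \<open>positions_M\<close> concerns the pairs that make up plays of the
  original game. \<open>E\<close> and \<open>N\<close> are arbitrary solutions of their recursions,
  because the formula quantifies over them.\<close>

locale coded_universe = coded_game \<theta> S \<kappa> \<mu> \<nu> As + universe M
  for \<theta> S \<kappa> \<mu> \<nu> :: "'v::zfc" and As and M :: "'v set" +
  fixes E N :: 'v
  assumes kappa_Ord: "Ord \<kappa>"
    and mem_M: "omega1 \<in> M" "\<kappa> \<in> M" "S \<in> M" "payoff \<in> M"
    and pairs_M: "\<And>x. elts x \<subseteq> (\<Union>a\<in>elts \<kappa>. opair a ` elts \<kappa>) \<Longrightarrow> x \<in> M"
    and positions_M: "(\<Union>\<xi>\<in>elts \<theta>. opair \<xi> ` elts S) \<subseteq> M"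
    and even: "is_even E omega1"
    and blocks: "is_block N omega1 \<mu>"
begin

lemma app_seq: "\<eta> \<in> elts omega1 \<Longrightarrow> opair \<eta> x \<in> elts (seq omega1 p) \<longleftrightarrow> x = p \<eta>"
  by auto

lemma two_omega1: "\<eta> \<in> elts omega1 \<Longrightarrow> two \<eta> \<in> elts omega1"
  unfolding two_def by (intro osucc_in_omega1)

lemma triple_kappa:
  assumes "p \<in> moves omega1 \<kappa>" "\<eta> \<in> elts omega1" "triple p \<eta> a b"
  shows "a \<in> elts \<kappa>" "b \<in> elts \<kappa>"
proof -
  have "osucc a \<in> elts \<kappa>" "osucc b \<in> elts \<kappa>"
    using assms two_omega1[OF assms(2)] two_omega1[OF two_omega1[OF assms(2)]]
    by (auto simp: moves_def triple_def dest: bspec)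
  then show "a \<in> elts \<kappa>" "b \<in> elts \<kappa>" using Ord_trans[OF kappa_Ord] by auto
qed

lemma is_triple_seq:
  assumes p: "p \<in> moves omega1 \<kappa>" and \<eta>: "\<eta> \<in> elts omega1"
  shows "is_triple z (seq omega1 p) \<eta> \<longleftrightarrow> (\<exists>a b. z = opair a b \<and> triple p \<eta> a b)"
proof -
  have two: "two \<eta> \<in> elts omega1" "two (two \<eta>) \<in> elts omega1" using \<eta> two_omega1 by blast+
  then have "is_triple z (seq omega1 p) \<eta> \<longleftrightarrow> (\<exists>a\<in>M. \<exists>b\<in>M. z = opair a b \<and> triple p \<eta> a b)"
    unfolding is_triple_def triple_def using \<eta> M_trans[OF mem_M(1)] by (auto simp: app_seq simp del: elts_seq)
  also have "\<dots> \<longleftrightarrow> (\<exists>a b. z = opair a b \<and> triple p \<eta> a b)"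
    using triple_kappa[OF p \<eta>] M_trans[OF mem_M(2)] by blast
  finally show ?thesis .
qed

lemma dec_M:
  assumes "p \<in> moves omega1 \<kappa>" "X \<subseteq> elts omega1"
  shows "dec p X \<in> M"
proof (rule pairs_M)
  have sm: "small X" using assms(2) by (rule small_subset[OF small_elts])
  show "elts (dec p X) \<subseteq> (\<Union>a\<in>elts \<kappa>. opair a ` elts \<kappa>)"
  proof
    fix z assume "z \<in> elts (dec p X)"
    then obtain a b \<eta> where z: "z = opair a b" "\<eta> \<in> X" "triple p \<eta> a b"
      unfolding elts_dec[OF sm] by blast
    then show "z \<in> (\<Union>a\<in>elts \<kappa>. opair a ` elts \<kappa>)"
      using triple_kappa[OF assms(1) subsetD[OF assms(2) z(2)] z(3)] by blast
  qed
qed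

lemma dec_eq_iff:
  assumes p: "p \<in> moves omega1 \<kappa>" and X: "X \<subseteq> elts omega1" and x: "x \<in> M"
  shows "(\<forall>z\<in>M. z \<in> elts x \<longleftrightarrow> (\<exists>\<eta>\<in>X. is_triple z (seq omega1 p) \<eta>)) \<longleftrightarrow> x = dec p X"
proof -
  have sm: "small X" using X by (rule small_subset[OF small_elts])
  have "z \<in> elts (dec p X) \<longleftrightarrow> (\<exists>\<eta>\<in>X. is_triple z (seq omega1 p) \<eta>)" for z
    using is_triple_seq[OF p subsetD[OF X]] by (auto simp: elts_dec[OF sm])
  then show ?thesis using M_eqI[OF elts_M[OF x] elts_M[OF dec_M[OF p X]]] by auto
qed

lemma first_turn_even: "\<eta> \<in> elts omega1 \<Longrightarrow> \<eta> \<in> elts E \<longleftrightarrow> first_turn \<eta>"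
  using even is_even_iff by blast

lemma init_slots_omega1: "init_slots \<nu> b \<subseteq> elts omega1"
  using omega1_trans[OF nu_omega1] by (auto simp: init_slots_def)

lemma is_dec_init_iff:
  assumes p: "p \<in> moves omega1 \<kappa>" and x: "x \<in> M"
  shows "is_dec_init \<nu> E (seq omega1 p) b x \<longleftrightarrow> x = dec p (init_slots \<nu> b)"
proof -
  have "(\<exists>\<eta>\<in>elts \<nu>. (\<eta> \<in> elts E \<longleftrightarrow> b) \<and> is_triple z (seq omega1 p) \<eta>) \<longleftrightarrow>
      (\<exists>\<eta>\<in>init_slots \<nu> b. is_triple z (seq omega1 p) \<eta>)" for z
    unfolding init_slots_def using first_turn_even[OF omega1_trans[OF nu_omega1]] by blast
  then show ?thesis unfolding is_dec_init_def dec_eq_iff[OF p init_slots_omega1 x, symmetric] by simp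
qed

lemma role_iff: "opair (osucc \<nu>) zero \<in> elts (seq omega1 p) \<longleftrightarrow> role p"
  using app_seq[OF osucc_nu(2)] by (auto simp: role_def simp del: elts_seq)

lemma is_dec_block_iff:
  assumes p: "p \<in> moves omega1 \<kappa>" and x: "x \<in> M" and \<xi>: "\<xi> \<in> elts omega1"
  shows "is_dec_block omega1 \<mu> (osucc \<nu>) N E (seq omega1 p) \<xi> x \<longleftrightarrow>
    x = dec p (slots \<mu> \<xi> (first_turn \<xi> \<longleftrightarrow> role p))"
proof -
  have N: "opair \<eta> \<xi> \<in> elts N \<longleftrightarrow> \<xi> = block \<mu> \<eta>" if "\<eta> \<in> elts omega1" for \<eta>
    using blocks is_block_iff[OF mem_M(1)] that M_trans[OF mem_M(1) \<xi>] by blast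
  have "(\<exists>\<eta>\<in>elts omega1. \<eta> \<notin> elts \<mu> \<and> opair \<eta> \<xi> \<in> elts N \<and>
      (\<eta> \<in> elts E \<longleftrightarrow> (\<xi> \<in> elts E \<longleftrightarrow> opair (osucc \<nu>) zero \<in> elts (seq omega1 p))) \<and> is_triple z (seq omega1 p) \<eta>) \<longleftrightarrow>
      (\<exists>\<eta>\<in>slots \<mu> \<xi> (first_turn \<xi> \<longleftrightarrow> role p). is_triple z (seq omega1 p) \<eta>)" for z
    unfolding role_iff first_turn_even[OF \<xi>] slots_def using N first_turn_even by blast
  moreover have "slots \<mu> \<xi> b \<subseteq> elts omega1" for b by (auto simp: slots_def)
  ultimately show ?thesis unfolding is_dec_block_def by (simp only: dec_eq_iff[OF p _ x])
qed

lemma is_move_iff: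
  assumes p: "p \<in> moves omega1 \<kappa>" and x: "x \<in> M" and \<xi>: "\<xi> \<in> elts \<theta>"
  shows "is_move omega1 \<mu> (osucc \<nu>) S N E (seq omega1 p) (dec p (init_slots \<nu> False)) \<xi> x \<longleftrightarrow> x = move p \<xi>"
proof -
  let ?d = "dec p (slots \<mu> \<xi> (first_turn \<xi> \<longleftrightarrow> role p))"
  note d = is_dec_block_iff[OF p _ subsetD[OF theta \<xi>]]
  have "(\<exists>d\<in>elts S. is_dec_block omega1 \<mu> (osucc \<nu>) N E (seq omega1 p) \<xi> d) \<longleftrightarrow> ?d \<in> elts S"
    using d M_trans[OF mem_M(3)] by blast
  then show ?thesis unfolding is_move_def d[OF x] by (auto simp: move_def Let_def)
qed

lemma is_win_iff:
  assumes p: "p \<in> moves omega1 \<kappa>" and v: "v \<in> M"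
    and As: "\<And>s. elts (As s) = (\<Union>A\<in>{A \<in> elts v. Q A s}. elts A)"
  shows "is_win omega1 \<mu> \<nu> (osucc \<nu>) \<theta> v Q S N E (seq omega1 p) \<longleftrightarrow> win p"
proof -
  let ?x = "dec p (init_slots \<nu> False)" and ?s = "dec p (init_slots \<nu> True)"
  note init = is_dec_init_iff[OF p]
  have g: "(\<forall>z\<in>M. z \<in> elts g \<longleftrightarrow> (\<exists>\<xi>\<in>elts \<theta>. \<exists>x\<in>M. z = opair \<xi> x \<and>
      is_move omega1 \<mu> (osucc \<nu>) S N E (seq omega1 p) ?x \<xi> x)) \<longleftrightarrow> g = seq \<theta> (move p)"
    if x: "?x \<in> elts S" and g: "g \<in> M" for g
  proof -
    have mS: "move p \<xi> \<in> elts S" for \<xi> using x by (simp add: move_def Let_def)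
    have "(\<exists>\<xi>\<in>elts \<theta>. \<exists>x\<in>M. z = opair \<xi> x \<and> is_move omega1 \<mu> (osucc \<nu>) S N E (seq omega1 p) ?x \<xi> x) \<longleftrightarrow>
        z \<in> elts (seq \<theta> (move p))" for z
      using is_move_iff[OF p] mS M_trans[OF mem_M(3)] by auto
    moreover have "elts (seq \<theta> (move p)) \<subseteq> M" using positions_M mS by auto
    ultimately show ?thesis using M_eqI[OF elts_M[OF g]] by auto
  qed
  have "(\<exists>s\<in>M. is_dec_init \<nu> E (seq omega1 p) True s \<and> (\<exists>A\<in>elts v. Q A s \<and>
      (\<exists>g\<in>elts A. \<forall>z\<in>M. z \<in> elts g \<longleftrightarrow> (\<exists>\<xi>\<in>elts \<theta>. \<exists>x\<in>M. z = opair \<xi> x \<and>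
        is_move omega1 \<mu> (osucc \<nu>) S N E (seq omega1 p) ?x \<xi> x)))) \<longleftrightarrow> seq \<theta> (move p) \<in> elts (As ?s)"
    if x: "?x \<in> elts S"
  proof -
    have "(\<exists>g\<in>elts A. \<forall>z\<in>M. z \<in> elts g \<longleftrightarrow> (\<exists>\<xi>\<in>elts \<theta>. \<exists>x\<in>M. z = opair \<xi> x \<and>
        is_move omega1 \<mu> (osucc \<nu>) S N E (seq omega1 p) ?x \<xi> x)) \<longleftrightarrow> seq \<theta> (move p) \<in> elts A"
      if "A \<in> elts v" for A
      using g[OF x M_trans[OF M_trans[OF v that]]] by auto
    then show ?thesis unfolding As using init dec_M[OF p init_slots_omega1[of True]] by auto
  qed
  moreover have "(\<forall>x\<^sub>0\<in>elts S. is_dec_init \<nu> E (seq omega1 p) False x\<^sub>0 \<longrightarrow> R x\<^sub>0) \<longleftrightarrow> (?x \<in> elts S \<longrightarrow> R ?x)" for R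
  proof -
    have "is_dec_init \<nu> E (seq omega1 p) False x\<^sub>0 \<longleftrightarrow> x\<^sub>0 = ?x" if "x\<^sub>0 \<in> elts S" for x\<^sub>0
      by (rule init[OF M_trans[OF mem_M(3) that]])
    then show ?thesis by auto
  qed
  ultimately show ?thesis unfolding is_win_def win_def role_iff by (simp only:) blast
qed

lemma is_play_iff: "is_play omega1 \<kappa> P \<longleftrightarrow> (\<exists>p\<in>moves omega1 \<kappa>. P = seq omega1 p)"
proof
  assume play: "is_play omega1 \<kappa> P"
  then have "\<forall>\<xi>\<in>elts omega1. \<exists>x\<in>elts \<kappa>. opair \<xi> x \<in> elts P \<and> (\<forall>y\<in>elts \<kappa>. opair \<xi> y \<in> elts P \<longrightarrow> y = x)"
    by (simp add: is_play_def)
  then obtain p where p: "\<And>\<xi>. \<xi> \<in> elts omega1 \<Longrightarrow> p \<xi> \<in> elts \<kappa> \<and> opair \<xi> (p \<xi>) \<in> elts P \<and>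
      (\<forall>y\<in>elts \<kappa>. opair \<xi> y \<in> elts P \<longrightarrow> y = p \<xi>)" by metis
  have "elts P = elts (seq omega1 p)"
  proof (intro set_eqI iffI)
    fix z assume "z \<in> elts P"
    then show "z \<in> elts (seq omega1 p)" using play p unfolding is_play_def by fastforce
  qed (use p in auto)
  then have "P = seq omega1 p" by (rule extensionality)
  then show "\<exists>p\<in>moves omega1 \<kappa>. P = seq omega1 p"
    using p by (intro bexI[of _ p]) (auto simp: moves_def)
next
  assume "\<exists>p\<in>moves omega1 \<kappa>. P = seq omega1 p"
  then obtain p where p: "p \<in> moves omega1 \<kappa>" "P = seq omega1 p" by blast
  then have "p \<xi> \<in> elts \<kappa>" if "\<xi> \<in> elts omega1" for \<xi> using that by (simp add: moves_def)
  then show "is_play omega1 \<kappa> P" unfolding is_play_def p(2) by (simp add: app_seq del: elts_seq) auto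
qed

lemma payoff_iff:
  assumes y: "y \<in> M" and v: "v \<in> M"
    and As: "\<And>s. elts (As s) = (\<Union>A\<in>{A \<in> elts v. Q A s}. elts A)"
  shows "(\<forall>P\<in>M. P \<in> elts y \<longleftrightarrow> is_play omega1 \<kappa> P \<and> is_win omega1 \<mu> \<nu> (osucc \<nu>) \<theta> v Q S N E P) \<longleftrightarrow> y = payoff"
proof -
  have "is_play omega1 \<kappa> P \<and> is_win omega1 \<mu> \<nu> (osucc \<nu>) \<theta> v Q S N E P \<longleftrightarrow> P \<in> elts payoff" for P
    using is_win_iff[OF _ v As] unfolding is_play_iff elts_payoff by blast
  then show ?thesis using M_eqI[OF elts_M[OF y] elts_M[OF mem_M(4)]] by auto
qed

end

section \<open>The payoff set of the coded game is ordinal definable\<close>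

context universe
begin

text \<open>
  The variables 1 to 8 stand for \<open>\<omega>\<^sub>1\<close>, \<open>\<kappa>\<close>, \<open>\<mu>\<close>, \<open>\<nu>\<close>, \<open>\<nu> + 1\<close>, \<open>\<theta>\<close> and the ordinals of the levels in which
  \<open>A\<close> and \<open>S\<close> are defined; the parameters of these two definitions are variables from 100 on.
  The places \<open>T\<close> of the definition of \<open>A\<close> are those that are held by \<open>s\<close>.
\<close>

definition is_payoff :: "fm \<Rightarrow> nat set \<Rightarrow> fm \<Rightarrow> nat set \<Rightarrow> (nat \<Rightarrow> 'a) \<Rightarrow> bool" where
  "is_payoff \<phi> T \<psi> T' e \<longleftrightarrow> (\<exists>v\<in>M. \<exists>v'\<in>M. is_level v (e 7) \<and> is_level v' (e 8) \<and>
     (\<exists>S\<in>elts v'. sat (elts v') \<psi> (\<lambda>n. if n = 0 then S else if n \<in> T' then S else e (101 + 3 * n)) \<and>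
     (\<exists>E\<in>M. \<exists>N\<in>M. is_even E (e 1) \<and> is_block N (e 1) (e 3) \<and>
       (\<forall>P\<in>M. P \<in> elts (e 0) \<longleftrightarrow> is_play (e 1) (e 2) P \<and>
         is_win (e 1) (e 3) (e 4) (e 5) (e 6) v
           (\<lambda>A s. sat (elts v) \<phi> (\<lambda>n. if n = 0 then A else if n \<in> T then s else e (100 + 3 * n)))
           S N E P))))"

lemma Dfn_is_payoff: "Dfn M (is_payoff \<phi> T \<psi> T')"
proof -
  define Q where "Q e A s \<longleftrightarrow> sat (elts (e 10)) \<phi> (\<lambda>n. if n = 0 then A else if n \<in> T then s else e (100 + 3 * n))"
    for e :: "nat \<Rightarrow> 'a" and A s
  \<comment> \<open>Quantified variables stay below 100, so updating them leaves the parameters of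
    both definitions alone.\<close>
  have far: "(e(k := v)) (100 + 3 * n) = e (100 + 3 * n)" "(e(k := v)) (101 + 3 * n) = e (101 + 3 * n)"
    if "k < 100" for e :: "nat \<Rightarrow> 'a" and k n v using that by auto
  have "Dfn M (\<lambda>e. Q e (e 18) (e 17))" unfolding Q_def by (rule Dfn_sat_params)
  moreover have "Q (e(k := v)) = Q e" if "k < 100" "k \<noteq> 10" for e k v
    unfolding Q_def far[OF that(1)] using that(2) by simp
  ultimately have win: "Dfn M (\<lambda>e. is_win (e 1) (e 3) (e 4) (e 5) (e 6) (e 10) (Q e) (e 12) (e 14) (e 13) (e 15))"
    by (rule Dfn_is_win)
  have "Dfn M (\<lambda>e. is_payoff \<phi> T \<psi> T' e)"
    unfolding is_payoff_def
    apply (rule Dfn_ex[where k = 10], simp add: far cong: if_cong)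
    apply (rule Dfn_ex[where k = 11], simp add: far cong: if_cong)
    apply (intro Dfn_conj Dfn_is_level)
    apply (rule Dfn_bex[where k = 12], simp, simp add: far cong: if_cong)
    apply (intro Dfn_conj Dfn_sat_params)
    apply (rule Dfn_ex[where k = 13], simp add: far cong: if_cong)
    apply (rule Dfn_ex[where k = 14], simp add: far cong: if_cong)
    apply (intro Dfn_conj Dfn_is_even Dfn_is_block)
    apply (rule Dfn_all[where k = 15], simp add: far cong: if_cong)
    apply (intro Dfn_equiv Dfn_conj Dfn_mem Dfn_is_play win[unfolded Q_def])
    done
  then show ?thesis .
qed

end

theorem theorem5:
  fixes \<theta> S A s :: "'v::zfc"
  assumes "determinacy_maximum TYPE('v)"
    and "game \<theta> S A"
    and "\<theta> \<in> elts omega1 \<or> \<theta> = omega1"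
    and "OD S"
    and "\<forall>x\<in>elts S. countable_ord_seq x"
    and "countable_ord_seq s"
    and "OD_from s A"
  shows "determined \<theta> S A"
proof -
  obtain \<alpha> \<phi> f where A: "Ord \<alpha>" "\<And>n. f n \<in> insert s {\<alpha>. Ord \<alpha>}" "\<And>n. f n \<in> Vlevel \<alpha>" "A \<in> Vlevel \<alpha>"
    "\<And>y. y \<in> Vlevel \<alpha> \<Longrightarrow> sat (Vlevel \<alpha>) \<phi> (f(0 := y)) \<longleftrightarrow> y = A"
    using assms(7) unfolding OD_from_def definable_in_level_def by blast
  obtain \<beta> \<psi> h where S: "Ord \<beta>" "\<And>n. Ord (h n)" "\<And>n. h n \<in> Vlevel \<beta>" "S \<in> Vlevel \<beta>"
    "\<And>y. y \<in> Vlevel \<beta> \<Longrightarrow> sat (Vlevel \<beta>) \<psi> (h(0 := y)) \<longleftrightarrow> y = S"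
    using assms(4) unfolding OD_def definable_in_level_def by blast
  \<comment> \<open>The definition of \<open>A\<close> may use \<open>s\<close> in several places;
    \<open>T\<close> records them, and the dummy \<open>zero\<close> there leaves \<open>f'\<close>
    with ordinal values only.\<close>
  define T where "T = {n. f n = s}"
  define f' where "f' n = (if n \<in> T then zero else f n)" for n
  define Q where "Q A' s' \<longleftrightarrow> sat (Vlevel \<alpha>) \<phi> (\<lambda>n. if n = 0 then A' else if n \<in> T then s' else f' n)" for A' s'
  \<comment> \<open>A union is defined for every \<open>s'\<close>, however many sets satisfy the
    definition. At \<open>s\<close> the only one is \<open>A\<close>, so the union is
    \<open>A\<close>.\<close>
  define As where "As s' = mkset (\<Union>A'\<in>{A' \<in> Vlevel \<alpha>. Q A' s'}. elts A')" for s'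
  have elts_As: "elts (As s') = (\<Union>A'\<in>{A' \<in> Vlevel \<alpha>. Q A' s'}. elts A')" for s'
    unfolding As_def by (rule elts_mkset[OF small_UN[OF small_subset[OF small_Vlevel[of \<alpha>]]]]) auto
  have As_s: "As s = A"
  proof (rule extensionality)
    have "(\<lambda>n. if n = 0 then A' else if n \<in> T then s else f' n) = f(0 := A')" for A'
      by (auto simp: T_def f'_def)
    then have "{A' \<in> Vlevel \<alpha>. Q A' s} = {A}" using A(4,5) by (auto simp: Q_def)
    then show "elts (As s) = elts A" by (simp add: elts_As)
  qed
  \<comment> \<open>Any countable limits with \<open>zero\<close> < \<nu> < \<mu> will do; the place
    \<open>osucc \<nu>\<close> for the choice of role then lies below \<mu>.\<close>
  obtain \<nu> where nu: "\<nu> \<in> elts omega1" "zero_or_limit \<nu>" "(zero::'v) \<in> elts \<nu>"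
    using limit_above_in_omega1[OF zero_in_omega1] by blast
  obtain \<mu> where mu: "\<mu> \<in> elts omega1" "zero_or_limit \<mu>" "\<nu> \<in> elts \<mu>"
    using limit_above_in_omega1[OF nu(1)] by blast
  have "\<forall>x\<in>insert s (elts S). \<exists>c. codes c x \<and> (\<forall>n. Ord (c n))"
    using assms(5,6) countable_ord_seq_codes by blast
  then obtain enc where enc: "\<And>x. x \<in> insert s (elts S) \<Longrightarrow> codes (enc x) x"
    "\<And>x n. x \<in> insert s (elts S) \<Longrightarrow> Ord (enc x n)" by metis
  \<comment> \<open>All entries of the chosen codes, together with the two moves that express the
    choice of a role; \<kappa> is an ordinal bounding them.\<close>
  define K where "K = {zero, osucc zero} \<union> (\<Union>x\<in>insert s (elts S). range (enc x))"
  have "small K"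
    unfolding K_def by (intro small_Un small_pair small_UN small_insert small_elts small_range_nat)
  moreover have "Ord x" if "x \<in> K" for x using that enc(2) by (auto simp: K_def)
  ultimately obtain \<kappa> where kappa: "Ord \<kappa>" "K \<subseteq> elts \<kappa>" using Ord_bound by blast
  have enc_\<kappa>: "range (enc x) \<subseteq> elts \<kappa>" if "x \<in> insert s (elts S)" for x
    using kappa(2) that unfolding K_def by blast
  have theta: "elts \<theta> \<subseteq> elts omega1" using assms(3) omega1_trans by blast
  have "Ord \<theta>" "elts S \<noteq> {}" using assms(2) by (auto simp: game_def)
  interpret G: coded_game \<theta> S \<kappa> \<mu> \<nu> As
  proof unfold_locales
    show "\<exists>c. codes c x \<and> range c \<subseteq> elts \<kappa>" if "x \<in> elts S" for x
      using enc(1)[of x] enc_\<kappa>[of x] that by blast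
  qed (use theta \<open>elts S \<noteq> {}\<close> nu mu kappa(2) in \<open>auto simp: K_def\<close>)
  define v where "v = mkset (Vlevel \<alpha>)"
  define v' where "v' = mkset (Vlevel \<beta>)"
  define E where "E = mkset {\<eta> \<in> elts omega1. first_turn (\<eta>::'v)}"
  define N where "N = seq omega1 (block \<mu>)"
  define k where "k = mkset ((\<lambda>\<beta>. mkset (Vlevel \<beta>)) ` elts \<alpha>)"
  define k' where "k' = mkset ((\<lambda>\<beta>. mkset (Vlevel \<beta>)) ` elts \<beta>)"
  define C where "C = mkset {x. elts x \<subseteq> (\<Union>a\<in>elts \<kappa>. opair a ` elts \<kappa>)}"
  define D where "D = mkset (\<Union>\<xi>\<in>elts \<theta>. opair \<xi> ` elts S)"
  have elts_C: "elts C = {x. elts x \<subseteq> (\<Union>a\<in>elts \<kappa>. opair a ` elts \<kappa>)}"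
    unfolding C_def by (intro elts_mkset small_Pow small_UN) auto
  have elts_D: "elts D = (\<Union>\<xi>\<in>elts \<theta>. opair \<xi> ` elts S)"
    unfolding D_def by (intro elts_mkset small_UN) auto
  \<comment> \<open>Besides the objects named in the formula, \<delta> must exceed the histories
    \<open>k\<close> and \<open>k'\<close>, and \<open>C\<close> and \<open>D\<close>, from which
    transitivity yields \<open>pairs_M\<close> and \<open>positions_M\<close>.\<close>
  have "small {omega1, \<kappa>, \<mu>, \<theta>, \<alpha>, \<beta>, S, G.payoff, v, v', E, N, k, k', C, D}"
    by (intro small_insert small_empty)
  then obtain \<delta> where d: "zero_or_limit \<delta>"
    "{omega1, \<kappa>, \<mu>, \<theta>, \<alpha>, \<beta>, S, G.payoff, v, v', E, N, k, k', C, D} \<subseteq> Vlevel \<delta>"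
    using limit_Vlevel_exists by blast
  then have in_M: "omega1 \<in> Vlevel \<delta>" "\<kappa> \<in> Vlevel \<delta>" "\<mu> \<in> Vlevel \<delta>" "\<theta> \<in> Vlevel \<delta>" "\<alpha> \<in> Vlevel \<delta>"
    "\<beta> \<in> Vlevel \<delta>" "S \<in> Vlevel \<delta>" "G.payoff \<in> Vlevel \<delta>" "v \<in> Vlevel \<delta>" "v' \<in> Vlevel \<delta>"
    "E \<in> Vlevel \<delta>" "N \<in> Vlevel \<delta>" "k \<in> Vlevel \<delta>" "k' \<in> Vlevel \<delta>" "C \<in> Vlevel \<delta>" "D \<in> Vlevel \<delta>"
    by simp_all
  interpret U: universe "Vlevel \<delta>" by (rule universe_Vlevel[OF d(1)])
  have elts_v: "elts v = Vlevel \<alpha>" "elts v' = Vlevel \<beta>" by (simp_all add: v_def v'_def)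
  have level: "U.is_level x \<alpha> \<longleftrightarrow> x = v" "U.is_level x \<beta> \<longleftrightarrow> x = v'" if "x \<in> Vlevel \<delta>" for x
    using U.is_level_iff[OF that A(1)] U.is_level_iff[OF that S(1)] in_M(13,14) extensionality[of x]
    unfolding k_def k'_def elts_v[symmetric] by blast+
  \<comment> \<open>Stated for all \<open>E'\<close> and \<open>N'\<close>, since any witnesses of
    the existential quantifiers must lead to the same payoff set.\<close>
  have cu: "coded_universe \<theta> S \<kappa> \<mu> \<nu> As (Vlevel \<delta>) E' N'"
    if "U.is_even E' omega1" "U.is_block N' omega1 \<mu>" for E' N'
  proof unfold_locales
    show "x \<in> Vlevel \<delta>" if "elts x \<subseteq> (\<Union>a\<in>elts \<kappa>. opair a ` elts \<kappa>)" for x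
      using U.M_trans[OF in_M(15)] that by (simp add: elts_C)
    show "(\<Union>\<xi>\<in>elts \<theta>. opair \<xi> ` elts S) \<subseteq> Vlevel \<delta>"
      using U.elts_M[OF in_M(16)] by (simp add: elts_D)
  qed (use kappa(1) in_M that in auto)
  have even: "U.is_even E omega1"
    unfolding U.is_even_iff E_def by (simp add: small_subset[OF small_elts[of omega1]])
  have block: "U.is_block N omega1 \<mu>"
    unfolding U.is_block_iff[OF in_M(1)] N_def by auto
  define e where "e n = (if n = 1 then omega1 else if n = 2 then \<kappa> else if n = 3 then \<mu> else
    if n = 4 then \<nu> else if n = 5 then osucc \<nu> else if n = 6 then \<theta> else if n = 7 then \<alpha> else
    if n = 8 then \<beta> else if n < 100 then zero else if n mod 3 = 1 then f' ((n - 100) div 3) else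
    if n mod 3 = 2 then h ((n - 101) div 3) else zero)" for n :: nat
  have nu_M: "\<nu> \<in> Vlevel \<delta>" "osucc \<nu> \<in> Vlevel \<delta>" "zero \<in> Vlevel \<delta>"
    using U.M_trans[OF in_M(3)] G.osucc_nu(1) mu(3) U.M_trans[OF _ nu(3)] by blast+
  have f': "Ord (f' n)" "f' n \<in> Vlevel \<delta>" for n
    using A(2)[of n] A(3)[of n] nu_M(3) U.elts_M[OF in_M(9)] by (auto simp: f'_def T_def elts_v)
  have h: "Ord (h n)" "h n \<in> Vlevel \<delta>" for n
    using S(2,3)[of n] U.elts_M[OF in_M(10)] by (auto simp: elts_v)
  have e_Ord: "e n \<in> {\<alpha>. Ord \<alpha>} \<inter> Vlevel \<delta>" for n
    unfolding e_def using in_M nu_M f' h omega1(1) kappa(1) limit_Ord[OF mu(2)] limit_Ord[OF nu(2)]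
      \<open>Ord \<theta>\<close> A(1) S(1) by auto
  have e_f: "e (100 + 3 * n) = f' n" and e_h: "e (101 + 3 * n) = h n" for n
  proof -
    have "(100 + 3 * n) mod 3 = 1" "(101 + 3 * n) mod 3 = 2" by presburger+
    then show "e (100 + 3 * n) = f' n" "e (101 + 3 * n) = h n" unfolding e_def by simp_all
  qed
  have e_num: "e 1 = omega1" "e 2 = \<kappa>" "e 3 = \<mu>" "e 4 = \<nu>" "e 5 = osucc \<nu>" "e 6 = \<theta>" "e 7 = \<alpha>" "e 8 = \<beta>"
    by (simp_all add: e_def)
  have payoff: "U.is_payoff \<phi> T \<psi> {} (e(0 := y)) \<longleftrightarrow> y = G.payoff" if y: "y \<in> Vlevel \<delta>" for y
  proof -
    have upd: "(e(0 := y)) (100 + 3 * n) = f' n" "(e(0 := y)) (101 + 3 * n) = h n" for n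
      by (simp_all add: e_f e_h)
    have S': "sat (elts v') \<psi> (\<lambda>n. if n = 0 then S' else if n \<in> {} then S' else h n) \<longleftrightarrow> S' = S"
      if "S' \<in> elts v'" for S'
    proof -
      have "(\<lambda>n. if n = 0 then S' else if n \<in> {} then S' else h n) = h(0 := S')" by auto
      then show ?thesis using S(5) that by (simp add: elts_v)
    qed
    have "elts (As s') = (\<Union>A'\<in>{A' \<in> elts v. sat (elts v) \<phi> (\<lambda>n. if n = 0 then A' else if n \<in> T then s' else f' n)}. elts A')" for s'
      by (simp add: elts_As elts_v Q_def)
    note P = coded_universe.payoff_iff[OF cu y in_M(9) this]
    have "U.is_payoff \<phi> T \<psi> {} (e(0 := y)) \<longleftrightarrow> (\<exists>E\<in>Vlevel \<delta>. \<exists>N\<in>Vlevel \<delta>. U.is_even E omega1 \<and> U.is_block N omega1 \<mu> \<and>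
       (\<forall>P\<in>Vlevel \<delta>. P \<in> elts y \<longleftrightarrow> U.is_play omega1 \<kappa> P \<and>
         U.is_win omega1 \<mu> \<nu> (osucc \<nu>) \<theta> v
           (\<lambda>A' s'. sat (elts v) \<phi> (\<lambda>n. if n = 0 then A' else if n \<in> T then s' else f' n)) S N E P))"
    proof -
      have "(e(0 := y)) 0 = y" "(e(0 := y)) 1 = omega1" "(e(0 := y)) 2 = \<kappa>" "(e(0 := y)) 3 = \<mu>" "(e(0 := y)) 4 = \<nu>"
        "(e(0 := y)) 5 = osucc \<nu>" "(e(0 := y)) 6 = \<theta>" "(e(0 := y)) 7 = \<alpha>" "(e(0 := y)) 8 = \<beta>"
        by (simp_all add: e_num del: One_nat_def)
      note vals = this upd
      have bex: "(\<exists>x\<in>Vlevel \<delta>. \<exists>x'\<in>Vlevel \<delta>. U.is_level x \<alpha> \<and> U.is_level x' \<beta> \<and> R x x') \<longleftrightarrow> R v v'" for R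
        using level in_M(9,10) by auto
      have bexS: "(\<exists>S'\<in>elts v'. sat (elts v') \<psi> (\<lambda>n. if n = 0 then S' else if n \<in> {} then S' else h n) \<and> R S') \<longleftrightarrow> R S" for R
        using S' S(4) elts_v(2) by auto
      show ?thesis unfolding U.is_payoff_def vals bex bexS ..
    qed
    also have "\<dots> \<longleftrightarrow> y = G.payoff"
      using P even block in_M(11,12) by blast
    finally show ?thesis .
  qed
  obtain \<chi> where chi: "\<And>e. range e \<subseteq> Vlevel \<delta> \<Longrightarrow> sat (Vlevel \<delta>) \<chi> e \<longleftrightarrow> U.is_payoff \<phi> T \<psi> {} e"
    using U.Dfn_is_payoff[of \<phi> T \<psi> "{}"] unfolding Dfn_def by blast
  have "sat (Vlevel \<delta>) \<chi> (e(0 := y)) \<longleftrightarrow> y = G.payoff" if "y \<in> Vlevel \<delta>" for y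
  proof -
    have "range (e(0 := y)) \<subseteq> Vlevel \<delta>" using e_Ord that by auto
    then show ?thesis using chi payoff[OF that] by blast
  qed
  then have "definable_in_level \<delta> {\<alpha>. Ord \<alpha>} G.payoff"
    unfolding definable_in_level_def using e_Ord in_M(8) by (intro exI[of _ \<chi>] exI[of _ e]) auto
  then have "OD G.payoff" unfolding OD_def using limit_Ord[OF d(1)] by blast
  then have "determined omega1 \<kappa> G.payoff"
    using assms(1) G.game_payoff kappa(1) unfolding determinacy_maximum_def by blast
  then have "determined \<theta> S (As s)"
    by (rule G.determined_original) (use enc(1)[of s] enc_\<kappa>[of s] in auto)
  then show ?thesis by (simp add: As_s)
qed

end
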